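(* Let $R$ be an integral domain, $n=2$, $R[\mathbf{x}]=R[x_1,x_2]$, and let $G$ be a subgroup of $\mathrm{Aff}(R,\mathbf{x})$. Let $\Gamma$ be a totally ordered additive group and $\mathbf{w}=(w_1,w_2)\in\Gamma^2$ with $w_1>0$ or $w_2>0$. If $\phi\in G^+$ satisfies $\deg_{\mathbf{w}}\phi>|\mathbf{w}|$, then $\phi$ admits a $\bar{G}$-reduction or an elementary reduction for the weight $\mathbf{w}$.
   Context: $\mathrm{Aut}(R[\mathbf{x}]/A)$ denotes the automorphisms of the ring $R[\mathbf{x}]$ over a subalgebra $A$; composition is $(\sigma\circ\tau)(f)=\sigma(\tau(f))$. An $R$-automorphism $\phi$ is affine if $\deg\phi(x_i)=1$ for all $i$ (total degree); it is elementary if $\phi\in\mathrm{Aut}(R[\mathbf{x}]/A_i)$ for some $i$, where $A_i=R[\{x_j: j\neq i\}]$. $\mathrm{Aff}(R,\mathbf{x})$, $\mathrm{E}(R,\mathbf{x})$, $\mathrm{T}(R,\mathbf{x})$ denote the subgroups generated by affine automorphisms, elementary automorphisms, and both, respectively. $G^+$ is the subgroup of $\mathrm{T}(R,\mathbf{x})$ generated by $G\cup\mathrm{E}(R,\mathbf{x})$. $\mathrm{E}_0(R,\mathbf{x})$ is the subgroup generated by $\bigcup_i \mathrm{Aut}(R[\mathbf{x}]/A_i)\cap\mathrm{Aff}(R,\mathbf{x})$, and $\bar G$ is the subgroup of $\mathrm{Aff}(R,\mathbf{x})$ generated by $G\cup\mathrm{E}_0(R,\mathbf{x})$. A totally ordered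 additive group is a finitely generated abelian group with a total order compatible with addition. For $\mathbf{w}\in\Gamma^2$, the $\mathbf{w}$-degree of a monomial $x_1^{a_1}x_2^{a_2}$ is $a_1w_1+a_2w_2$, $\deg_{\mathbf{w}}f$ is the maximum over monomials of $f\ne0$, $\deg_{\mathbf{w}}\phi=\deg_{\mathbf{w}}\phi(x_1)+\deg_{\mathbf{w}}\phi(x_2)$ and $|\mathbf{w}|=w_1+w_2$. $\phi$ admits a $\bar G$-reduction for $\mathbf{w}$ if $\deg_{\mathbf{w}}(\phi\circ\alpha)<\deg_{\mathbf{w}}\phi$ for some $\alpha\in\bar G$, and an elementary reduction for $\mathbf{w}$ if $\deg_{\mathbf{w}}(\phi\circ\epsilon)<\deg_{\mathbf{w}}\phi$ for some $\epsilon\in\mathrm{Aut}(R[\mathbf{x}]/A_i)$, $i\in\{1,2\}$. *)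

theory Defs
  imports "HOL-Computational_Algebra.Polynomial"
begin

text \<open>Bivariate polynomials R[x1,x2] are represented as 'a poly poly:
  the outer variable is x2, the coefficients are polynomials in x1.
  The coefficient of the monomial x1^i x2^j in g is coeff (coeff g j) i.\<close>

type_synonym 'a bipoly = "'a poly poly"

definition X1 :: "'a::comm_ring_1 bipoly" where "X1 = [:[:0, 1:]:]"
definition X2 :: "'a::comm_ring_1 bipoly" where "X2 = [:0, 1:]"

text \<open>An R-endomorphism of R[x1,x2] is given by the images of x1 and x2.\<close>
type_synonym 'a endo2 = "'a bipoly \<times> 'a bipoly"

definition eval2 :: "'a::comm_ring_1 bipoly \<Rightarrow> 'a bipoly \<Rightarrow> 'a bipoly \<Rightarrow> 'a bipoly" where
  "eval2 p q g = poly (map_poly (\<lambda>c. poly (map_poly (\<lambda>a. [:[:a:]:]) c) p) g) q"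

definition app :: "'a::comm_ring_1 endo2 \<Rightarrow> 'a bipoly \<Rightarrow> 'a bipoly" where
  "app \<phi> g = eval2 (fst \<phi>) (snd \<phi>) g"

definition comp2 :: "'a::comm_ring_1 endo2 \<Rightarrow> 'a endo2 \<Rightarrow> 'a endo2" where
  "comp2 \<sigma> \<tau> = (app \<sigma> (fst \<tau>), app \<sigma> (snd \<tau>))"

definition id2 :: "'a::comm_ring_1 endo2" where "id2 = (X1, X2)"

definition is_inverse2 :: "'a::comm_ring_1 endo2 \<Rightarrow> 'a endo2 \<Rightarrow> bool" where
  "is_inverse2 \<phi> \<psi> \<longleftrightarrow> comp2 \<phi> \<psi> = id2 \<and> comp2 \<psi> \<phi> = id2"

definition is_aut :: "'a::comm_ring_1 endo2 \<Rightarrow> bool" where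
  "is_aut \<phi> \<longleftrightarrow> (\<exists>\<psi>. is_inverse2 \<phi> \<psi>)"

inductive_set gen2 :: "'a::comm_ring_1 endo2 set \<Rightarrow> 'a endo2 set" for S where
  gen_id: "id2 \<in> gen2 S"
| gen_base: "s \<in> S \<Longrightarrow> s \<in> gen2 S"
| gen_inv: "s \<in> S \<Longrightarrow> is_inverse2 s \<psi> \<Longrightarrow> \<psi> \<in> gen2 S"
| gen_comp: "a \<in> gen2 S \<Longrightarrow> b \<in> gen2 S \<Longrightarrow> comp2 a b \<in> gen2 S"

definition supp2 :: "'a::zero bipoly \<Rightarrow> (nat \<times> nat) set" where
  "supp2 g = {(i, j). coeff (coeff g j) i \<noteq> 0}"

definition tdeg :: "'a::zero bipoly \<Rightarrow> nat" where
  "tdeg g = Max ((\<lambda>(i, j). i + j) ` supp2 g)"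

definition affine_aut :: "'a::comm_ring_1 endo2 \<Rightarrow> bool" where
  "affine_aut \<phi> \<longleftrightarrow> is_aut \<phi> \<and> tdeg (fst \<phi>) = 1 \<and> tdeg (snd \<phi>) = 1"

text \<open>A_1 = R[x2], A_2 = R[x1].\<close>
definition A_sub :: "nat \<Rightarrow> 'a::comm_ring_1 bipoly set" where
  "A_sub i = (if i = 1 then {a. \<forall>j. degree (coeff a j) = 0} else {a. degree a = 0})"

definition aut_over :: "nat \<Rightarrow> 'a::comm_ring_1 endo2 set" where
  "aut_over i = {\<phi>. is_aut \<phi> \<and> (\<forall>a \<in> A_sub i. app \<phi> a = a)}"

definition Aff :: "'a::comm_ring_1 endo2 set" where
  "Aff = gen2 {\<phi>. affine_aut \<phi>}"

definition Elem :: "'a::comm_ring_1 endo2 set" where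
  "Elem = gen2 (aut_over 1 \<union> aut_over 2)"

definition Tame :: "'a::comm_ring_1 endo2 set" where
  "Tame = gen2 ({\<phi>. affine_aut \<phi>} \<union> aut_over 1 \<union> aut_over 2)"

definition Gplus :: "'a::comm_ring_1 endo2 set \<Rightarrow> 'a endo2 set" where
  "Gplus G = gen2 (G \<union> aut_over 1 \<union> aut_over 2)"

definition E0 :: "'a::comm_ring_1 endo2 set" where
  "E0 = gen2 ((aut_over 1 \<inter> Aff) \<union> (aut_over 2 \<inter> Aff))"

definition Gbar :: "'a::comm_ring_1 endo2 set \<Rightarrow> 'a endo2 set" where
  "Gbar G = gen2 (G \<union> E0)"

definition subgroup2 :: "'a::comm_ring_1 endo2 set \<Rightarrow> 'a endo2 set \<Rightarrow> bool" where
  "subgroup2 G H \<longleftrightarrow> G \<subseteq> H \<and> id2 \<in> G \<and> (\<forall>a\<in>G. \<forall>b\<in>G. comp2 a b \<in> G)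
     \<and> (\<forall>a\<in>G. \<forall>\<psi>. is_inverse2 a \<psi> \<longrightarrow> \<psi> \<in> G)"

definition nmul :: "nat \<Rightarrow> 'g::ab_group_add \<Rightarrow> 'g" where
  "nmul n g = (\<Sum>_\<in>{..<n}. g)"

definition zmul :: "int \<Rightarrow> 'g::ab_group_add \<Rightarrow> 'g" where
  "zmul k g = (if k \<ge> 0 then nmul (nat k) g else - nmul (nat (- k)) g)"

definition fin_gen_group :: "'g::ab_group_add itself \<Rightarrow> bool" where
  "fin_gen_group _ \<longleftrightarrow> (\<exists>S::'g set. finite S \<and> (\<forall>x. \<exists>c. x = (\<Sum>s\<in>S. zmul (c s) s)))"

definition wdeg :: "'g::linordered_ab_group_add \<times> 'g \<Rightarrow> 'a::zero bipoly \<Rightarrow> 'g" where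
  "wdeg w g = Max ((\<lambda>(i, j). nmul i (fst w) + nmul j (snd w)) ` supp2 g)"

definition wdeg_endo :: "'g::linordered_ab_group_add \<times> 'g \<Rightarrow> 'a::zero endo2 \<Rightarrow> 'g" where
  "wdeg_endo w \<phi> = wdeg w (fst \<phi>) + wdeg w (snd \<phi>)"

definition wnorm :: "'g::linordered_ab_group_add \<times> 'g \<Rightarrow> 'g" where
  "wnorm w = fst w + snd w"

end

theory Submission
  imports Defs
begin

text \<open>Write \<open>\<phi> = \<alpha>\<^sub>0 \<epsilon>\<^sub>1 \<alpha>\<^sub>1 \<dots> \<epsilon>\<^sub>l \<alpha>\<^sub>l\<close> with \<open>\<alpha>\<^sub>i\<close> in \<open>Gbar G\<close> and the \<open>\<epsilon>\<^sub>i\<close> elementary and not affine,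
  such that no two consecutive \<open>\<epsilon>\<^sub>i\<close> can be merged across the affine map between them. Then every
  \<open>\<epsilon>\<^sub>i\<close>, except possibly the first, raises the weighted degree of the component it changes to a
  proper multiple of the degree \<open>D > 0\<close> of the other one, so after \<open>\<epsilon>\<^sub>l\<close> this component
  strictly dominates. If both components of \<open>\<alpha>\<^sub>l\<close> involve the dominant variable, then \<open>\<alpha>\<^sub>l\<inverse>\<close>
  reduces \<open>\<phi>\<close>. Otherwise \<open>\<alpha>\<^sub>l\<inverse> \<epsilon>\<^sub>l\<inverse> \<alpha>\<^sub>l\<close> is elementary and reduces \<open>\<phi>\<close>, unless \<open>l = 1\<close>
  and the weight absorbs \<open>\<epsilon>\<^sub>1\<close>; in that case a translation brings the degree down to \<open>|w|\<close>.\<close>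

section \<open>Substitution\<close>

definition C2 :: "'a::comm_ring_1 \<Rightarrow> 'a bipoly" where
  "C2 a = [:[:a:]:]"

definition ev1 :: "'a::comm_ring_1 bipoly \<Rightarrow> 'a poly \<Rightarrow> 'a bipoly" where
  "ev1 f P = poly (map_poly C2 P) f"

lemma C2_simps [simp]:
  "C2 0 = 0" "C2 1 = 1" "C2 (a + b) = C2 a + C2 b" "C2 (a * b) = C2 a * C2 b" "C2 (- a) = - C2 a"
  "C2 a = 0 \<longleftrightarrow> a = 0" "C2 a = C2 b \<longleftrightarrow> a = b"
  by (auto simp: C2_def one_pCons)

lemma C2_diff [simp]: "C2 (a - b) = C2 a - C2 b"
  using C2_simps(3)[of a "- b"] by simp

lemma ev1_0 [simp]: "ev1 f 0 = 0"
  by (simp add: ev1_def)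

lemma ev1_pCons [simp]: "ev1 f (pCons a P) = C2 a + f * ev1 f P"
  by (simp add: ev1_def map_poly_pCons)

lemma ev1_1 [simp]: "ev1 f 1 = 1"
  by (simp add: one_pCons)

lemma ev1_add [simp]: "ev1 f (P + Q) = ev1 f P + ev1 f Q"
  by (induction P Q rule: poly_induct2) (simp_all add: algebra_simps)

lemma ev1_smult [simp]: "ev1 f (smult a P) = C2 a * ev1 f P"
  by (induction P) (simp_all add: algebra_simps)

lemma ev1_mult [simp]: "ev1 f (P * Q) = ev1 f P * ev1 f Q"
  by (induction P) (simp_all add: algebra_simps)

lemma app_0 [simp]: "app \<phi> 0 = 0"
  by (simp add: app_def eval2_def)

text \<open>Horner's rule in the outer variable. It turns \<open>eval2\<close> into a recursion
  along \<open>pCons\<close>, so that induction shows \<open>app\<close> to be a ring homomorphism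
  fixing the constants.\<close>

lemma app_pCons: "app \<phi> (pCons c g) = ev1 (fst \<phi>) c + snd \<phi> * app \<phi> g"
  by (simp add: app_def eval2_def map_poly_pCons ev1_def C2_def[abs_def])

lemma app_add [simp]: "app \<phi> (f + g) = app \<phi> f + app \<phi> g"
  by (induction f g rule: poly_induct2) (simp_all add: app_pCons algebra_simps)

lemma app_smult: "app \<phi> (smult c g) = ev1 (fst \<phi>) c * app \<phi> g"
  by (induction g) (simp_all add: app_pCons algebra_simps)

lemma app_mult [simp]: "app \<phi> (f * g) = app \<phi> f * app \<phi> g"
  by (induction f) (simp_all add: app_pCons app_smult algebra_simps)

lemma app_C2 [simp]: "app \<phi> (C2 a) = C2 a"
  by (simp add: C2_def app_pCons)

lemma app_uminus [simp]: "app \<phi> (- f) = - app \<phi> f"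
  using app_add[of \<phi> f "- f"] by (simp add: eq_neg_iff_add_eq_0 add.commute)

lemma app_diff [simp]: "app \<phi> (f - g) = app \<phi> f - app \<phi> g"
  using app_add[of \<phi> f "- g"] by simp

lemma app_X1: "app \<phi> X1 = fst \<phi>"
  by (simp add: X1_def app_pCons)

lemma app_X2: "app \<phi> X2 = snd \<phi>"
  by (simp add: X2_def app_pCons)

lemma app_id2: "app id2 f = f"
proof -
  have *: "ev1 X1 c = [:c:]" for c :: "'a poly"
    by (induction c) (auto simp: X1_def C2_def)
  show ?thesis
    by (induction f) (simp_all add: app_pCons id2_def * X2_def)
qed

lemma app_ev1 [simp]: "app \<phi> (ev1 f P) = ev1 (app \<phi> f) P"
  by (induction P) simp_all

section \<open>Composition, inverses and generated groups\<close>

lemma app_comp2 [simp]: "app (comp2 \<sigma> \<tau>) f = app \<sigma> (app \<tau> f)"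
  by (induction f) (simp_all add: app_pCons comp2_def)

lemma fst_comp2: "fst (comp2 \<sigma> \<tau>) = app \<sigma> (fst \<tau>)"
  and snd_comp2: "snd (comp2 \<sigma> \<tau>) = app \<sigma> (snd \<tau>)"
  by (simp_all add: comp2_def)

lemma comp2_assoc: "comp2 (comp2 a b) c = comp2 a (comp2 b c)"
  by (simp add: prod_eq_iff fst_comp2 snd_comp2)

lemma comp2_id2 [simp]: "comp2 id2 a = a" "comp2 a id2 = a"
  by (simp_all add: comp2_def app_id2) (simp add: id2_def app_X1 app_X2)

lemma is_inverse2_sym: "is_inverse2 a b \<Longrightarrow> is_inverse2 b a"
  by (auto simp: is_inverse2_def)

lemma is_inverse2_app:
  assumes "is_inverse2 a b"
  shows "app a (app b f) = f" "app b (app a f) = f"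
  using assms app_comp2[of a b f] app_comp2[of b a f]
  by (simp_all add: is_inverse2_def app_id2)

lemma is_inverse2_comp2:
  assumes "is_inverse2 a a'" "is_inverse2 b b'"
  shows "is_inverse2 (comp2 a b) (comp2 b' a')"
proof -
  have "comp2 b (comp2 b' a') = a'" "comp2 a' (comp2 a b) = b"
    using assms by (simp_all add: is_inverse2_def flip: comp2_assoc)
  then show ?thesis
    using assms by (simp add: is_inverse2_def comp2_assoc)
qed

lemma is_inverse2_id2: "is_inverse2 id2 id2"
  by (simp add: is_inverse2_def)

lemma is_aut_comp2: "is_aut a \<Longrightarrow> is_aut b \<Longrightarrow> is_aut (comp2 a b)"
  unfolding is_aut_def by (elim exE) (rule exI, rule is_inverse2_comp2)

lemma is_aut_app_inject:
  assumes "is_aut a" "app a f = app a g"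
  shows "f = g"
proof -
  obtain b where "is_inverse2 a b" using assms(1) unfolding is_aut_def ..
  then show ?thesis using assms(2) is_inverse2_app(2)[of a b] by metis
qed

text \<open>The rules of \<open>gen2\<close> invert generators only. Products are inverted by
  reversing the order of their factors.\<close>

lemma gen2_inverse:
  assumes "\<And>s. s \<in> S \<Longrightarrow> is_aut s" "a \<in> gen2 S"
  shows "\<exists>b \<in> gen2 S. is_inverse2 a b"
  using assms(2)
proof induction
  case gen_id
  show ?case by (rule bexI[where x = id2]) (simp_all add: is_inverse2_id2 gen2.gen_id)
next
  case (gen_base s)
  then obtain t where "is_inverse2 s t" using assms(1) unfolding is_aut_def by blast
  then show ?case using gen2.gen_inv[OF gen_base] by blast
next
  case (gen_inv s \<psi>)
  show ?case by (rule bexI[where x = s]) (simp_all add: is_inverse2_sym[OF gen_inv(2)] gen2.gen_base[OF gen_inv(1)])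
next
  case (gen_comp a b)
  then obtain a' b' where "a' \<in> gen2 S" "is_inverse2 a a'" "b' \<in> gen2 S" "is_inverse2 b b'"
    by blast
  then show ?case by (intro bexI[where x = "comp2 b' a'"] is_inverse2_comp2 gen2.gen_comp)
qed

section \<open>The two variables\<close>

text \<open>For an index \<open>p\<close> in {1, 2} the other index is \<open>3 - p\<close>, so one
  statement treats both variables. Every number other than 1 stands for the second variable.\<close>

definition V :: "nat \<Rightarrow> 'a::comm_ring_1 bipoly" where
  "V i = (if i = 1 then X1 else X2)"

abbreviation is_index :: "nat \<Rightarrow> bool" where
  "is_index p \<equiv> p = 1 \<or> p = 2"

lemma endo2_eqI: "is_index p \<Longrightarrow> app a (V p) = app b (V p) \<Longrightarrow>
  app a (V (3 - p)) = app b (V (3 - p)) \<Longrightarrow> a = b"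
  by (auto simp: V_def app_X1 app_X2 prod_eq_iff)

text \<open>Replaces the coefficient condition in \<open>A_sub\<close> by substitution of the other
  variable into a univariate polynomial; closure properties are then inherited from
  \<open>ev1\<close>.\<close>

lemma A_sub_iff_ev1:
  assumes "is_index p"
  shows "f \<in> A_sub p \<longleftrightarrow> (\<exists>P. f = ev1 (V (3 - p)) P)"
proof (cases "p = 1")
  case True
  have *: "ev1 X2 P = map_poly (\<lambda>a. [:a:]) P" for P :: "'a poly"
    by (induction P) (auto simp: map_poly_pCons X2_def C2_def)
  have "degree (coeff (ev1 X2 P) j) = 0" for P :: "'a poly" and j
    by (simp add: * coeff_map_poly)
  moreover have "\<exists>P. f = ev1 X2 P" if "\<forall>j. degree (coeff f j) = 0" for f :: "'a bipoly"
  proof -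
    have const: "[:coeff c 0:] = c" if "degree c = 0" for c :: "'a poly"
      using that by (auto elim: degree_eq_zeroE)
    have "f = map_poly (\<lambda>a. [:a:]) (map_poly (\<lambda>c. coeff c 0) f)"
      using that by (intro poly_eqI) (simp add: coeff_map_poly const)
    then show ?thesis using * by metis
  qed
  ultimately show ?thesis
    using True by (auto simp: A_sub_def V_def)
next
  case False
  have *: "ev1 X1 c = [:c:]" for c :: "'a poly"
    by (induction c) (auto simp: X1_def C2_def)
  show ?thesis
    using False assms by (auto simp: A_sub_def V_def * elim!: degree_eq_zeroE)
qed

lemma V_in_A_sub: "is_index p \<Longrightarrow> V (3 - p) \<in> A_sub p"
  unfolding A_sub_iff_ev1 by (rule exI[of _ "[:0, 1:]"]) simp

text \<open>The subalgebra \<open>A_sub p\<close> is generated over R by the single variable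
  \<open>V (3 - p)\<close>, so fixing that variable suffices.\<close>

lemma aut_over_iff:
  assumes "is_index p"
  shows "\<epsilon> \<in> aut_over p \<longleftrightarrow> is_aut \<epsilon> \<and> app \<epsilon> (V (3 - p)) = V (3 - p)"
proof -
  have "app \<epsilon> a = a" if "app \<epsilon> (V (3 - p)) = V (3 - p)" "a \<in> A_sub p" for a
    using that app_ev1 by (metis A_sub_iff_ev1[OF assms])
  then show ?thesis
    using V_in_A_sub[OF assms] by (auto simp only: aut_over_def mem_Collect_eq)
qed

section \<open>Elementary automorphisms: group laws and explicit form\<close>

lemma aut_over_comp2:
  "is_index p \<Longrightarrow> a \<in> aut_over p \<Longrightarrow> b \<in> aut_over p \<Longrightarrow> comp2 a b \<in> aut_over p"
  by (simp add: aut_over_iff is_aut_comp2)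

lemma aut_over_inverse:
  assumes "is_index p" "a \<in> aut_over p" "is_inverse2 a b"
  shows "b \<in> aut_over p"
proof -
  have "is_aut b"
    using is_inverse2_sym[OF assms(3)] unfolding is_aut_def by blast
  then show ?thesis
    using is_inverse2_app(2)[OF assms(3), of "V (3 - p)"] assms(2)
    by (simp add: aut_over_iff[OF assms(1)])
qed

text \<open>An automorphism fixing x1 acts by \<open>pcompose\<close> over the coefficient ring
  R[x1]. The degrees in x2 of the images of x2 under it and its inverse multiply to 1, so both are
  1; the two leading coefficients have product 1 in R[x1], hence are constants because R is a
  domain.\<close>

lemma aut_over_2_form:
  fixes \<epsilon> :: "'a::idom endo2"
  assumes "is_aut \<epsilon>" "app \<epsilon> X1 = X1"
  shows "\<exists>u P. u \<noteq> 0 \<and> app \<epsilon> X2 = C2 u * X2 + ev1 X1 P"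
proof -
  have ev: "ev1 X1 c = [:c:]" for c :: "'a poly"
    by (induction c) (auto simp: X1_def C2_def)
  have pc: "app \<phi> f = pcompose f (app \<phi> X2)" if "app \<phi> X1 = X1" for \<phi> and f :: "'a bipoly"
    using that
    by (induction f) (simp_all add: app_pCons app_X1 ev app_X2 pcompose_pCons)
  obtain \<psi> where inv: "is_inverse2 \<epsilon> \<psi>" using assms(1) by (auto simp: is_aut_def)
  define f g where "f = app \<epsilon> X2" and "g = app \<psi> X2"
  have gf: "pcompose g f = X2"
    using pc[OF assms(2), of g] is_inverse2_app(1)[OF inv, of X2] by (simp add: f_def g_def)
  have "degree g * degree f = 1"
    using gf degree_pcompose[of g f] by (simp add: X2_def)
  then have deg: "degree f = 1" "degree g = 1" by auto
  obtain a b where f: "f = [:a, b:]"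
    using deg(1) by (metis One_nat_def degree1_coeffs)
  obtain c d where g: "g = [:c, d:]"
    using deg(2) by (metis One_nat_def degree1_coeffs)
  have "d * b = 1"
    using gf by (simp add: f g pcompose_pCons X2_def one_pCons)
  then have "b \<noteq> 0" "d \<noteq> 0" by auto
  then have "degree b = 0"
    using \<open>d * b = 1\<close> degree_mult_eq[of d b] by simp
  then obtain u where u: "b = [:u:]" "u \<noteq> 0" by (metis \<open>b \<noteq> 0\<close> degree_eq_zeroE pCons_0_0)
  have "f = C2 u * X2 + ev1 X1 a"
    by (simp add: f u(1) ev C2_def X2_def)
  then show ?thesis using u(2) unfolding f_def by blast
qed

lemma aut_over_form:
  fixes \<epsilon> :: "'a::idom endo2"
  assumes p: "is_index p" and e: "\<epsilon> \<in> aut_over p"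
  shows "\<exists>u P. u \<noteq> 0 \<and> app \<epsilon> (V p) = C2 u * V p + ev1 (V (3 - p)) P"
proof (cases "p = 2")
  case True
  then show ?thesis using e aut_over_2_form[of \<epsilon>] by (simp add: aut_over_iff V_def)
next
  case False
  then have p1: "p = 1" using p by simp
  \<comment> \<open>Conjugation by the swap of the variables reduces \<open>p = 1\<close> to the
    case of x2.\<close>
  define s :: "'a endo2" where "s = (X2, X1)"
  have s: "app s X1 = X2" "app s X2 = X1" by (simp_all add: s_def app_X1 app_X2)
  have inv: "is_inverse2 s s"
    unfolding is_inverse2_def by (simp add: comp2_def id2_def s_def app_X1 app_X2)
  then have "is_aut s" unfolding is_aut_def by blast
  have e1: "is_aut \<epsilon>" "app \<epsilon> X2 = X2" using e p1 by (simp_all add: aut_over_iff V_def)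
  have "is_aut (comp2 s (comp2 \<epsilon> s))" using is_aut_comp2 e1 \<open>is_aut s\<close> by blast
  moreover have "app (comp2 s (comp2 \<epsilon> s)) X1 = X1" by (simp add: s e1)
  ultimately obtain u P where u: "u \<noteq> 0" "app s (app \<epsilon> (app s X2)) = C2 u * X2 + ev1 X1 P"
    using aut_over_2_form[of "comp2 s (comp2 \<epsilon> s)"] by auto
  have "app \<epsilon> X1 = app s (C2 u * X2 + ev1 X1 P)"
    using u(2) is_inverse2_app(1)[OF inv, of "app \<epsilon> X1"] by (simp only: s)
  then show ?thesis using u(1) p1 by (auto simp: s V_def)
qed


section \<open>Weighted degrees\<close>

definition wt :: "'g::linordered_ab_group_add \<times> 'g \<Rightarrow> nat \<Rightarrow> nat \<Rightarrow> 'g" where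
  "wt w i j = nmul i (fst w) + nmul j (snd w)"

definition wle :: "'g::linordered_ab_group_add \<times> 'g \<Rightarrow> 'g \<Rightarrow> 'a::zero bipoly \<Rightarrow> bool" where
  "wle w d f \<longleftrightarrow> (\<forall>i j. coeff (coeff f j) i \<noteq> 0 \<longrightarrow> wt w i j \<le> d)"

definition wlt :: "'g::linordered_ab_group_add \<times> 'g \<Rightarrow> 'g \<Rightarrow> 'a::zero bipoly \<Rightarrow> bool" where
  "wlt w d f \<longleftrightarrow> (\<forall>i j. coeff (coeff f j) i \<noteq> 0 \<longrightarrow> wt w i j < d)"

text \<open>Unlike \<^const>\<open>wdeg\<close>, whose value at 0 is the junk value of \<^const>\<open>Max\<close> at the empty set,
  these predicates behave well at 0: it satisfies \<^const>\<open>wle\<close> and \<^const>\<open>wlt\<close> for every degree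
  and \<open>has_wdeg\<close> for none.\<close>

definition has_wdeg :: "'g::linordered_ab_group_add \<times> 'g \<Rightarrow> 'g \<Rightarrow> 'a::zero bipoly \<Rightarrow> bool" where
  "has_wdeg w d f \<longleftrightarrow> wle w d f \<and> (\<exists>i j. coeff (coeff f j) i \<noteq> 0 \<and> wt w i j = d)"

lemma nmul_0 [simp]: "nmul 0 g = 0"
  and nmul_Suc [simp]: "nmul (Suc n) g = g + nmul n g"
  by (simp_all add: nmul_def lessThan_Suc)

lemma nmul_add: "nmul (m + n) g = nmul m g + nmul n g"
  by (induction m) (simp_all add: algebra_simps)

lemma nmul_nonneg: "0 \<le> g \<Longrightarrow> 0 \<le> nmul n (g :: 'g::linordered_ab_group_add)"
  by (induction n) simp_all

lemma less_nmul:
  fixes g :: "'g::linordered_ab_group_add"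
  assumes "0 < g" "2 \<le> n"
  shows "g < nmul n g"
proof -
  obtain k where "n = Suc (Suc k)" using assms(2) by (auto simp: numeral_2_eq_2 Suc_le_eq less_iff_Suc_add)
  then show ?thesis
    using assms(1) nmul_nonneg[of g k] by (simp add: add_pos_nonneg)
qed

lemma wt_add: "wt w (i + i') (j + j') = wt w i j + wt w i' j'"
  by (simp add: wt_def nmul_add algebra_simps)

section \<open>Existence and uniqueness of the weighted degree\<close>

lemma finite_supp2: "finite (supp2 f)"
proof (rule finite_subset)
  show "supp2 f \<subseteq> (\<Union>j\<in>{..degree f}. {..degree (coeff f j)} \<times> {j})"
    by (auto simp: supp2_def intro!: le_degree)
qed simp

lemma supp2_nonempty: "f \<noteq> 0 \<Longrightarrow> supp2 f \<noteq> {}"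
  by (auto simp: supp2_def poly_eq_iff)

lemma has_wdeg_wdeg:
  assumes "f \<noteq> 0"
  shows "has_wdeg w (wdeg w f) f"
proof -
  let ?A = "(\<lambda>(i, j). wt w i j) ` supp2 f"
  have A: "finite ?A" "?A \<noteq> {}" using finite_supp2 supp2_nonempty[OF assms] by auto
  have e: "wdeg w f = Max ?A" by (simp add: wdeg_def wt_def)
  have "wle w (wdeg w f) f"
    unfolding wle_def e using A by (auto intro!: Max_ge simp: supp2_def)
  moreover have "\<exists>i j. coeff (coeff f j) i \<noteq> 0 \<and> wt w i j = wdeg w f"
    using Max_in[OF A] unfolding e by (auto simp: supp2_def) blast
  ultimately show ?thesis by (simp add: has_wdeg_def)
qed

lemma has_wdeg_unique: "has_wdeg w d f \<Longrightarrow> has_wdeg w e f \<Longrightarrow> d = e"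
  unfolding has_wdeg_def wle_def by (elim conjE exE) (rule antisym; blast)

lemma has_wdeg_nonzero: "has_wdeg w d f \<Longrightarrow> f \<noteq> 0"
  by (auto simp: has_wdeg_def)

lemma wdeg_eqI: "has_wdeg w d f \<Longrightarrow> wdeg w f = d"
  by (rule has_wdeg_unique[OF has_wdeg_wdeg[OF has_wdeg_nonzero]])

lemma wdeg_le: "f \<noteq> 0 \<Longrightarrow> wle w d f \<Longrightarrow> wdeg w f \<le> d"
  using has_wdeg_wdeg[of f w] unfolding has_wdeg_def wle_def by metis

lemma wdeg_less: "f \<noteq> 0 \<Longrightarrow> wlt w d f \<Longrightarrow> wdeg w f < d"
  using has_wdeg_wdeg[of f w] unfolding has_wdeg_def wlt_def by metis

lemma has_wdeg_wle: "has_wdeg w d f \<Longrightarrow> wle w d f"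
  by (simp add: has_wdeg_def)

lemma wlt_wle: "wlt w d f \<Longrightarrow> wle w d f"
  by (simp add: wlt_def wle_def less_imp_le)

lemma wle_mono: "wle w d f \<Longrightarrow> d \<le> e \<Longrightarrow> wle w e f"
  unfolding wle_def by (meson order_trans)

lemma wle_wlt: "wle w d f \<Longrightarrow> d < e \<Longrightarrow> wlt w e f"
  unfolding wle_def wlt_def by (meson le_less_trans)

section \<open>Degrees of sums and products\<close>

lemma wle_add: "wle w d f \<Longrightarrow> wle w d g \<Longrightarrow> wle w d (f + g)"
  unfolding wle_def coeff_add using add.right_neutral[of 0] by metis

lemma wlt_add: "wlt w d f \<Longrightarrow> wlt w d g \<Longrightarrow> wlt w d (f + g)"
  unfolding wlt_def coeff_add using add.right_neutral[of 0] by metis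

lemma has_wdeg_add:
  fixes f g :: "'a::comm_ring_1 bipoly"
  assumes "has_wdeg w d f" "wlt w d g"
  shows "has_wdeg w d (f + g)"
proof -
  obtain i j where ij: "coeff (coeff f j) i \<noteq> 0" "wt w i j = d"
    using assms(1) by (auto simp: has_wdeg_def)
  have "coeff (coeff g j) i = 0" using assms(2) ij(2) by (auto simp: wlt_def)
  then have "coeff (coeff (f + g) j) i \<noteq> 0" using ij(1) by simp
  then show ?thesis
    using ij(2) wle_add[OF has_wdeg_wle[OF assms(1)] wlt_wle[OF assms(2)]]
    unfolding has_wdeg_def by blast
qed

lemma coeff_mult_nonzero:
  fixes f g :: "'a::comm_ring_1 bipoly"
  assumes "coeff (coeff (f * g) j) i \<noteq> 0"
  shows "\<exists>i1 j1 i2 j2. i = i1 + i2 \<and> j = j1 + j2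
    \<and> coeff (coeff f j1) i1 \<noteq> 0 \<and> coeff (coeff g j2) i2 \<noteq> 0"
proof -
  have "(\<Sum>k\<le>j. coeff (coeff f k * coeff g (j - k)) i) \<noteq> 0"
    using assms by (simp add: coeff_mult[of f g] coeff_sum)
  then obtain k where k: "k \<le> j" "coeff (coeff f k * coeff g (j - k)) i \<noteq> 0"
    by (metis (no_types, lifting) atMost_iff sum.not_neutral_contains_not_neutral)
  then have "(\<Sum>l\<le>i. coeff (coeff f k) l * coeff (coeff g (j - k)) (i - l)) \<noteq> 0"
    by (simp add: coeff_mult)
  then obtain l where l: "l \<le> i" "coeff (coeff f k) l * coeff (coeff g (j - k)) (i - l) \<noteq> 0"
    by (metis (no_types, lifting) atMost_iff sum.not_neutral_contains_not_neutral)
  have "i = l + (i - l)" "j = k + (j - k)" "coeff (coeff f k) l \<noteq> 0"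
    "coeff (coeff g (j - k)) (i - l) \<noteq> 0"
    using k(1) l by auto
  then show ?thesis by blast
qed

lemma wle_mult:
  fixes f g :: "'a::comm_ring_1 bipoly"
  assumes "wle w d f" "wle w e g"
  shows "wle w (d + e) (f * g)"
  unfolding wle_def
proof (intro allI impI)
  fix i j assume "coeff (coeff (f * g) j) i \<noteq> 0"
  then obtain i1 j1 i2 j2 where "i = i1 + i2" "j = j1 + j2"
    "coeff (coeff f j1) i1 \<noteq> 0" "coeff (coeff g j2) i2 \<noteq> 0"
    using coeff_mult_nonzero by blast
  then show "wt w i j \<le> d + e"
    using assms by (simp add: wt_add wle_def add_mono)
qed

lemma wlt_mult:
  fixes f g :: "'a::comm_ring_1 bipoly"
  assumes "wlt w d f" "wle w e g"
  shows "wlt w (d + e) (f * g)"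
  unfolding wlt_def
proof (intro allI impI)
  fix i j assume "coeff (coeff (f * g) j) i \<noteq> 0"
  then obtain i1 j1 i2 j2 where "i = i1 + i2" "j = j1 + j2"
    "coeff (coeff f j1) i1 \<noteq> 0" "coeff (coeff g j2) i2 \<noteq> 0"
    using coeff_mult_nonzero by blast
  then show "wt w i j < d + e"
    using assms by (simp add: wt_add wle_def wlt_def add_less_le_mono)
qed

text \<open>Used to cut out leading forms. Finiteness of the support is inherited from
  \<open>f\<close>, first within each coefficient and then in the outer variable, hence the two uses
  of \<open>Abs_poly\<close>.\<close>

lemma bipoly_restrict:
  fixes f :: "'a::zero bipoly"
  shows "\<exists>h. \<forall>i j. coeff (coeff h j) i = (if Q i j then coeff (coeff f j) i else 0)"
proof -
  define c where "c j = Abs_poly (\<lambda>i. if Q i j then coeff (coeff f j) i else 0)" for j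
  have c: "coeff (c j) i = (if Q i j then coeff (coeff f j) i else 0)" for i j
    unfolding c_def by (subst coeff_Abs_poly[of "degree (coeff f j)"]) (auto simp: coeff_eq_0)
  have "c j = 0" if "j > degree f" for j
    using that by (intro poly_eqI) (simp add: c coeff_eq_0)
  then have "coeff (Abs_poly c) = c"
    by (intro ext, subst coeff_Abs_poly[of "degree f"]) auto
  then show ?thesis using c by metis
qed

lemma top_form:
  fixes f :: "'a::comm_ring_1 bipoly"
  assumes "has_wdeg w d f"
  shows "\<exists>t r. f = t + r \<and> t \<noteq> 0 \<and> wlt w d r \<and> (\<forall>i j. coeff (coeff t j) i \<noteq> 0 \<longrightarrow> wt w i j = d)"
proof -
  obtain t where t: "\<And>i j. coeff (coeff t j) i = (if wt w i j = d then coeff (coeff f j) i else 0)"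
    using bipoly_restrict[of "\<lambda>i j. wt w i j = d" f] by blast
  have "t \<noteq> 0" using assms t by (auto simp: has_wdeg_def) (metis coeff_0)
  moreover have "wlt w d (f - t)"
    using assms by (auto simp: wlt_def has_wdeg_def wle_def t order.strict_iff_order)
  ultimately show ?thesis
    using t by (intro exI[of _ t] exI[of _ "f - t"]) auto
qed

text \<open>Over a domain the product of the two leading forms is nonzero. All its monomials have
  weight \<open>d + e\<close>, and every other contribution to \<open>f * g\<close> lies strictly
  below.\<close>

lemma has_wdeg_mult:
  fixes f g :: "'a::idom bipoly"
  assumes "has_wdeg w d f" "has_wdeg w e g"
  shows "has_wdeg w (d + e) (f * g)"
proof -
  obtain t r where f: "f = t + r" "t \<noteq> 0" "wlt w d r"
    "\<And>i j. coeff (coeff t j) i \<noteq> 0 \<Longrightarrow> wt w i j = d"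
    using top_form[OF assms(1)] by blast
  obtain t' r' where g: "g = t' + r'" "t' \<noteq> 0" "wlt w e r'"
    "\<And>i j. coeff (coeff t' j) i \<noteq> 0 \<Longrightarrow> wt w i j = e"
    using top_form[OF assms(2)] by blast
  have "t * t' \<noteq> 0" using f(2) g(2) by simp
  then obtain i j where ij: "coeff (coeff (t * t') j) i \<noteq> 0"
    by (metis coeff_0 poly_eqI)
  then obtain i1 j1 i2 j2 where "i = i1 + i2" "j = j1 + j2"
    "coeff (coeff t j1) i1 \<noteq> 0" "coeff (coeff t' j2) i2 \<noteq> 0"
    using coeff_mult_nonzero by blast
  then have wt: "wt w i j = d + e" using f(4) g(4) by (simp add: wt_add)
  have top: "has_wdeg w (d + e) (t * t')"
    using ij wt wle_mult[of w d t e t'] f(4) g(4) by (auto simp: has_wdeg_def wle_def)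
  have t: "wle w d t" using f(4) by (auto simp: wle_def)
  have "wlt w (d + e) (r * g)" "wlt w (e + d) (r' * t)"
    using wlt_mult[OF f(3) has_wdeg_wle[OF assms(2)]] wlt_mult[OF g(3) t] by simp_all
  then have "wlt w (d + e) (r * g + r' * t)" by (simp add: wlt_add add.commute)
  moreover have "f * g = t * t' + (r * g + r' * t)" by (simp add: f(1) g(1) algebra_simps)
  ultimately show ?thesis using has_wdeg_add[OF top] by simp
qed

section \<open>Degrees of constants, variables and substitutions\<close>

lemma coeff_C2: "coeff (coeff (C2 a) j) i = (if i = 0 \<and> j = 0 then a else 0)"
  by (auto simp: C2_def coeff_pCons split: nat.splits)

lemma has_wdeg_C2: "a \<noteq> 0 \<Longrightarrow> has_wdeg w 0 (C2 a)"
  by (auto simp: has_wdeg_def wle_def coeff_C2 wt_def)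

lemma wle_C2: "wle w 0 (C2 a)"
  by (auto simp: wle_def coeff_C2 wt_def)

definition wV :: "'g \<times> 'g \<Rightarrow> nat \<Rightarrow> 'g" where
  "wV w p = (if p = 1 then fst w else snd w)"

lemma has_wdeg_V: "has_wdeg w (wV w p) (V p :: 'a::comm_ring_1 bipoly)"
proof -
  have "coeff (coeff (X1 :: 'a bipoly) j) i = (if i = 1 \<and> j = 0 then 1 else 0)"
    "coeff (coeff (X2 :: 'a bipoly) j) i = (if i = 0 \<and> j = 1 then 1 else 0)" for i j
    by (auto simp: X1_def X2_def coeff_pCons split: nat.splits)
  then show ?thesis
    by (auto simp: has_wdeg_def wle_def wV_def V_def wt_def)
qed

lemma wle_C2_mult: "wle w d f \<Longrightarrow> wle w d (C2 a * f)"
  using wle_mult[OF wle_C2, of w d f a] by simp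

lemma wlt_C2_mult: "wlt w d f \<Longrightarrow> wlt w d (C2 a * f)"
  using wlt_mult[OF _ wle_C2, of w d f a] by (simp add: mult.commute)

lemma has_wdeg_C2_mult:
  fixes f :: "'a::idom bipoly"
  shows "a \<noteq> 0 \<Longrightarrow> has_wdeg w d f \<Longrightarrow> has_wdeg w d (C2 a * f)"
  using has_wdeg_mult[OF has_wdeg_C2, of a w d f] by simp

text \<open>Each Horner step adds a constant, of degree 0, to a multiple of \<open>f\<close> of
  positive degree; so nothing cancels at the top.\<close>

lemma has_wdeg_ev1:
  fixes f :: "'a::idom bipoly"
  assumes "has_wdeg w d f" "0 < d" "P \<noteq> 0"
  shows "has_wdeg w (nmul (degree P) d) (ev1 f P)"
  using assms(3)
proof (induction P)
  case (pCons a P)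
  show ?case
  proof (cases "P = 0")
    case True
    then show ?thesis using pCons.prems by (simp add: has_wdeg_C2)
  next
    case False
    then have *: "has_wdeg w (nmul (Suc (degree P)) d) (f * ev1 f P)"
      using has_wdeg_mult[OF assms(1)] pCons.IH by simp
    have "0 < nmul (Suc (degree P)) d"
      using assms(2) by (simp add: add_pos_nonneg nmul_nonneg)
    then have "has_wdeg w (nmul (Suc (degree P)) d) (f * ev1 f P + C2 a)"
      by (intro has_wdeg_add[OF *] wle_wlt[OF wle_C2])
    then show ?thesis using False by (simp add: add.commute)
  qed
qed simp

text \<open>Counterpart for a weight that is not positive, where powers of \<open>f\<close> do not
  grow.\<close>

lemma wle_ev1:
  assumes "wle w 0 f"
  shows "wle w 0 (ev1 f P)"
proof (induction P)
  case (pCons a P)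
  then show ?case using wle_mult[OF assms pCons.IH] by (simp add: wle_add wle_C2)
qed (simp add: wle_def)

lemma wdeg_endo_eq:
  "is_index p \<Longrightarrow> wdeg_endo w \<phi> = wdeg w (app \<phi> (V p)) + wdeg w (app \<phi> (V (3 - p)))"
  by (auto simp: wdeg_endo_def V_def app_X1 app_X2 add.commute)

lemma wnorm_eq: "is_index p \<Longrightarrow> wnorm w = wV w p + wV w (3 - p)"
  by (auto simp: wnorm_def wV_def add.commute)

section \<open>Affine automorphisms\<close>

lemma A_sub_add: "is_index p \<Longrightarrow> f \<in> A_sub p \<Longrightarrow> g \<in> A_sub p \<Longrightarrow> f + g \<in> A_sub p"
  unfolding A_sub_iff_ev1 by (metis ev1_add)

lemma A_sub_C2_mult: "is_index p \<Longrightarrow> f \<in> A_sub p \<Longrightarrow> C2 a * f \<in> A_sub p"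
  unfolding A_sub_iff_ev1 by (metis ev1_smult)

lemma A_sub_C2: "is_index p \<Longrightarrow> C2 a \<in> A_sub p"
  unfolding A_sub_iff_ev1 by (rule exI[of _ "[:a:]"]) simp

definition vcoeff :: "nat \<Rightarrow> 'a::zero bipoly \<Rightarrow> 'a" where
  "vcoeff p f = (if p = 1 then coeff (coeff f 0) 1 else coeff (coeff f 1) 0)"

lemma vcoeff_add: "vcoeff p (f + g) = vcoeff p f + vcoeff p g"
  by (simp add: vcoeff_def)

lemma coeff_C2_mult: "coeff (coeff (C2 a * f) j) i = a * coeff (coeff f j) i"
  by (simp add: C2_def)

lemma vcoeff_C2_mult: "vcoeff p (C2 a * f) = a * vcoeff p f"
  by (simp add: vcoeff_def coeff_C2_mult)

lemma vcoeff_V: "is_index p \<Longrightarrow> vcoeff p (V p) = 1"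
  by (auto simp: vcoeff_def V_def X1_def X2_def)

lemma vcoeff_A_sub: "is_index p \<Longrightarrow> f \<in> A_sub p \<Longrightarrow> vcoeff p f = 0"
  by (auto simp: vcoeff_def A_sub_def coeff_eq_0)

lemma wV_le: "is_index p \<Longrightarrow> wle w d f \<Longrightarrow> vcoeff p f \<noteq> 0 \<Longrightarrow> wV w p \<le> d"
  unfolding wle_def vcoeff_def wV_def
  by (elim disjE) (drule spec2[of _ 1 0], simp add: wt_def, drule spec2[of _ 0 1], simp add: wt_def)

lemma vcoeff_form:
  assumes "is_index p" "r \<in> A_sub p"
  shows "vcoeff p (C2 a * V p + r) = a"
  using assms by (simp add: vcoeff_add vcoeff_C2_mult vcoeff_V vcoeff_A_sub)

text \<open>The summand \<open>r\<close> is free of \<open>V p\<close>, so it cannot cancel that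
  monomial even when it has the same weight. \<open>has_wdeg_add\<close> would demand a strictly
  smaller weight of \<open>r\<close>.\<close>

lemma has_wdeg_form:
  fixes r :: "'a::idom bipoly"
  assumes "is_index p" "r \<in> A_sub p" "a \<noteq> 0" "wle w (wV w p) r"
  shows "has_wdeg w (wV w p) (C2 a * V p + r)"
proof -
  let ?f = "C2 a * V p + r"
  have "has_wdeg w (wV w p) (C2 a * V p)"
    by (rule has_wdeg_C2_mult[OF assms(3) has_wdeg_V])
  then have le: "wle w (wV w p) ?f"
    by (intro wle_add has_wdeg_wle assms(4))
  have f: "vcoeff p ?f \<noteq> 0" using vcoeff_form[OF assms(1,2)] assms(3) by simp
  have "?f \<noteq> 0"
  proof
    assume "?f = 0"
    then show False using f unfolding \<open>?f = 0\<close> by (simp add: vcoeff_def split: if_splits)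
  qed
  then have "has_wdeg w (wdeg w ?f) ?f" by (rule has_wdeg_wdeg)
  moreover have "wdeg w ?f = wV w p"
    using wdeg_le[OF \<open>?f \<noteq> 0\<close> le] wV_le[OF assms(1) has_wdeg_wle[OF has_wdeg_wdeg] f] \<open>?f \<noteq> 0\<close>
    by (intro antisym)
  ultimately show ?thesis by simp
qed

definition affine_form :: "'a::comm_ring_1 bipoly \<Rightarrow> bool" where
  "affine_form f \<longleftrightarrow> (\<forall>i j. coeff (coeff f j) i \<noteq> 0 \<longrightarrow> i + j \<le> 1)"

lemma affine_form_iff:
  assumes "is_index p"
  shows "affine_form f \<longleftrightarrow> (\<exists>a b c. f = C2 a * V p + C2 b * V (3 - p) + C2 c)"
proof -
  have co: "coeff (coeff (C2 a * X1 + C2 b * X2 + C2 c) j) i =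
      (if i = 0 \<and> j = 0 then c else if i = 1 \<and> j = 0 then a else if i = 0 \<and> j = 1 then b else 0)"
    for a b c :: 'a and i j
    by (auto simp: C2_def X1_def X2_def coeff_pCons split: nat.splits)
  have "affine_form f \<longleftrightarrow> (\<exists>a b c. f = C2 a * X1 + C2 b * X2 + C2 c)"
  proof
    assume f: "affine_form f"
    have "coeff (coeff f j) i = coeff (coeff (C2 (coeff (coeff f 0) 1) * X1
        + C2 (coeff (coeff f 1) 0) * X2 + C2 (coeff (coeff f 0) 0)) j) i" for i j
    proof (cases "i + j \<le> 1")
      case True
      then have "(i, j) \<in> {(0, 0), (1, 0), (0, 1)}" by auto
      then show ?thesis unfolding co by auto
    next
      case False
      then have "coeff (coeff f j) i = 0" using f unfolding affine_form_def by blast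
      then show ?thesis using False unfolding co by auto
    qed
    then show "\<exists>a b c. f = C2 a * X1 + C2 b * X2 + C2 c"
      by (intro exI poly_eqI)
  next
    assume "\<exists>a b c. f = C2 a * X1 + C2 b * X2 + C2 c"
    then show "affine_form f" by (auto simp only: affine_form_def co split: if_splits)
  qed
  moreover have "(\<exists>a b c. f = C2 a * X1 + C2 b * X2 + C2 c) \<longleftrightarrow>
    (\<exists>a b c. f = C2 a * X2 + C2 b * X1 + C2 c)"
    by (subst ex_comm) (simp only: add.commute)
  ultimately show ?thesis using assms by (auto simp: V_def)
qed

lemma affine_form_add: "affine_form f \<Longrightarrow> affine_form g \<Longrightarrow> affine_form (f + g)"
  unfolding affine_form_def coeff_add using add.right_neutral[of 0] by metis

lemma affine_form_C2_mult: "affine_form f \<Longrightarrow> affine_form (C2 a * f)"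
  unfolding affine_form_def coeff_C2_mult by (auto dest!: mult_not_zero)

lemma affine_form_C2: "affine_form (C2 a)"
  by (auto simp: affine_form_def coeff_C2)

lemma affine_form_V: "affine_form (V p)"
  by (auto simp: affine_form_def V_def X1_def X2_def coeff_pCons split: nat.splits)

lemma affine_form_cancel:
  fixes f :: "'a::idom bipoly"
  shows "a \<noteq> 0 \<Longrightarrow> affine_form (C2 a * f) \<Longrightarrow> affine_form f"
  by (simp add: affine_form_def coeff_C2_mult)

lemma affine_form_A_sub_iff:
  assumes "is_index p"
  shows "C2 a * V p + C2 b * V (3 - p) + C2 c \<in> A_sub p \<longleftrightarrow> a = 0"
proof -
  have r: "C2 b * V (3 - p) + C2 c \<in> A_sub p"
    using assms by (intro A_sub_add A_sub_C2_mult A_sub_C2 V_in_A_sub)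
  then show ?thesis
    using vcoeff_form[OF assms r, of a] vcoeff_A_sub[OF assms, of "C2 a * V p + (C2 b * V (3 - p) + C2 c)"]
    by (cases "a = 0") (simp_all add: add.assoc, blast)
qed

lemma affine_form_A_sub:
  assumes "is_index p" "affine_form f" "f \<in> A_sub p"
  shows "\<exists>b c. f = C2 b * V (3 - p) + C2 c"
proof -
  obtain a b c where f: "f = C2 a * V p + C2 b * V (3 - p) + C2 c"
    using assms(2) affine_form_iff[OF assms(1)] by blast
  moreover have "a = 0" using assms(3) affine_form_A_sub_iff[OF assms(1)] unfolding f by blast
  ultimately show ?thesis by auto
qed

section \<open>The group of affine automorphisms\<close>

definition lin_aut :: "'a::comm_ring_1 endo2 \<Rightarrow> bool" where
  "lin_aut \<phi> \<longleftrightarrow> is_aut \<phi> \<and> (\<forall>p. affine_form (app \<phi> (V p)))"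

lemma lin_autI:
  assumes "is_aut \<phi>" "is_index p" "affine_form (app \<phi> (V p))" "affine_form (app \<phi> (V (3 - p)))"
  shows "lin_aut \<phi>"
  using assms by (auto simp: lin_aut_def V_def)

lemma affine_form_app:
  assumes "lin_aut \<phi>" "affine_form f"
  shows "affine_form (app \<phi> f)"
proof -
  obtain a b c where "f = C2 a * V 1 + C2 b * V (3 - 1) + C2 c"
    using assms(2) affine_form_iff[of 1] by blast
  then show ?thesis
    using assms(1) by (simp add: lin_aut_def affine_form_add affine_form_C2_mult affine_form_C2)
qed

lemma lin_aut_comp2: "lin_aut a \<Longrightarrow> lin_aut b \<Longrightarrow> lin_aut (comp2 a b)"
  using affine_form_app[of a] by (simp add: lin_aut_def is_aut_comp2)

text \<open>An automorphism is injective and fixes constants, so the combination equals the constant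
  before \<open>\<phi>\<close> is applied, and coefficients can be compared.\<close>

lemma is_aut_indep:
  assumes "is_aut \<phi>" "app \<phi> (C2 s * X1 + C2 t * X2) = C2 k"
  shows "s = 0" "t = 0"
proof -
  have e: "C2 s * X1 + C2 t * X2 = C2 k"
    using is_aut_app_inject[OF assms(1), of _ "C2 k"] assms(2) by simp
  have "vcoeff 1 (C2 s * X1 + C2 t * X2) = s" "vcoeff 2 (C2 s * X1 + C2 t * X2) = t"
    "vcoeff p (C2 k) = 0" for p
    by (auto simp: vcoeff_def C2_def X1_def X2_def)
  then show "s = 0" "t = 0" using e by metis+
qed

lemma app_V_nonconst:
  assumes "is_aut \<phi>" "is_index p"
  shows "app \<phi> (V p) \<noteq> C2 k"
  using is_aut_indep[OF assms(1), of "if p = 1 then 1 else 0" "if p = 1 then 0 else 1" k] assms(2)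
  by (auto simp: V_def)

lemma app_V_nonzero: "is_aut \<phi> \<Longrightarrow> is_index p \<Longrightarrow> app \<phi> (V p) \<noteq> 0"
  using app_V_nonconst[of \<phi> p 0] by simp

text \<open>Two affine images in the same single variable admit a combination eliminating it. By
  \<open>is_aut_indep\<close> the coefficients of this combination vanish, and then a variable is
  sent to a constant.\<close>

lemma not_both_in_A_sub:
  assumes "lin_aut \<phi>" "is_index p" "is_index i"
  shows "app \<phi> (V i) \<notin> A_sub p \<or> app \<phi> (V (3 - i)) \<notin> A_sub p"
proof (rule ccontr)
  assume "\<not> ?thesis"
  then have "app \<phi> X1 \<in> A_sub p" "app \<phi> X2 \<in> A_sub p"
    using assms(3) by (auto simp: V_def)
  moreover have "affine_form (app \<phi> (V 1))" "affine_form (app \<phi> (V 2))"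
    using assms(1) unfolding lin_aut_def by blast+
  ultimately obtain b c b' c' where e: "app \<phi> X1 = C2 b * V (3 - p) + C2 c"
    "app \<phi> X2 = C2 b' * V (3 - p) + C2 c'"
    using affine_form_A_sub[OF assms(2)] by (fastforce simp: V_def)
  have aut: "is_aut \<phi>" using assms(1) by (simp add: lin_aut_def)
  have "app \<phi> (C2 b' * X1 + C2 (- b) * X2) = C2 (b' * c - b * c')"
    by (simp add: e algebra_simps)
  from is_aut_indep[OF aut this] have "b = 0" by simp
  then have "app \<phi> (V 1) = C2 c" by (simp add: e V_def)
  then show False using app_V_nonconst[OF aut, of 1 c] by simp
qed

text \<open>Cramer's rule without division: \<open>D\<close> times each image under
  \<open>\<psi>\<close> is affine, and over a domain a nonzero factor \<open>D\<close> can be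
  cancelled from this condition.\<close>

lemma lin_aut_inverse:
  fixes \<phi> :: "'a::idom endo2"
  assumes "lin_aut \<phi>" "is_inverse2 \<phi> \<psi>"
  shows "lin_aut \<psi>"
proof -
  have aut: "is_aut \<phi>" "is_aut \<psi>"
    using assms is_inverse2_sym unfolding lin_aut_def is_aut_def by blast+
  have "affine_form (app \<phi> (V 1))" using assms(1) unfolding lin_aut_def by blast
  then obtain a b e where 1: "app \<phi> X1 = C2 a * X1 + C2 b * X2 + C2 e"
    using affine_form_iff[of 1 "app \<phi> (V 1)"] by (auto simp: V_def)
  have "affine_form (app \<phi> (V 2))" using assms(1) unfolding lin_aut_def by blast
  then obtain c d f where 2: "app \<phi> X2 = C2 c * X1 + C2 d * X2 + C2 f"
    using affine_form_iff[of 1 "app \<phi> (V 2)"] by (auto simp: V_def)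
  define D where "D = a * d - b * c"
  \<comment> \<open>With \<open>D = 0\<close> the rows of the adjugate matrix give combinations of
    x1 and x2 that \<open>\<phi>\<close> sends to constants, so all four entries of the matrix
    vanish.\<close>
  have "D \<noteq> 0"
  proof
    assume D: "D = 0"
    have "app \<phi> (C2 d * X1 + C2 (- b) * X2) = C2 D * X1 + C2 (d * e - b * f)"
      "app \<phi> (C2 (- c) * X1 + C2 a * X2) = C2 D * X2 + C2 (a * f - c * e)"
      by (simp_all add: 1 2 D_def algebra_simps)
    then have "app \<phi> (C2 d * X1 + C2 (- b) * X2) = C2 (d * e - b * f)"
      "app \<phi> (C2 (- c) * X1 + C2 a * X2) = C2 (a * f - c * e)"
      by (simp_all only: D C2_simps(1) mult_zero_left add_0)
    then have "d = 0" "a = 0" "- b = 0" "- c = 0"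
      by (blast dest: is_aut_indep[OF aut(1)])+
    then have "app \<phi> (V 1) = C2 e" by (simp add: 1 V_def)
    then show False using app_V_nonconst[OF aut(1), of 1 e] by simp
  qed
  define y z where "y = app \<psi> X1" and "z = app \<psi> X2"
  have X: "C2 a * y + C2 b * z + C2 e = X1" "C2 c * y + C2 d * z + C2 f = X2"
    using is_inverse2_app(2)[OF assms(2), of X1] is_inverse2_app(2)[OF assms(2), of X2]
    by (simp_all add: 1 2 y_def z_def)
  have "C2 D * y = C2 d * X1 + C2 (- b) * X2 + C2 (b * f - d * e)"
    "C2 D * z = C2 (- c) * X1 + C2 a * X2 + C2 (c * e - a * f)"
    unfolding X[symmetric] D_def by (simp_all add: algebra_simps)
  moreover have "affine_form (C2 s * X1 + C2 t * X2 + C2 k)" for s t k :: 'a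
    using affine_form_iff[of 1] by (auto simp: V_def)
  ultimately have "affine_form y" "affine_form z"
    using affine_form_cancel[OF \<open>D \<noteq> 0\<close>] by metis+
  then show ?thesis
    using lin_autI[OF aut(2), of 1] by (simp add: V_def y_def z_def)
qed

lemma tdeg_eq_1_iff:
  "tdeg f = 1 \<longleftrightarrow> affine_form f \<and> (\<forall>k. f \<noteq> C2 k)" if "f \<noteq> 0"
proof -
  let ?A = "(\<lambda>(i, j). i + j) ` supp2 f"
  have A: "finite ?A" "?A \<noteq> {}" using finite_supp2 supp2_nonempty[OF that] by auto
  have le: "tdeg f \<le> n \<longleftrightarrow> (\<forall>i j. coeff (coeff f j) i \<noteq> 0 \<longrightarrow> i + j \<le> n)" for n
    unfolding tdeg_def Max_le_iff[OF A] by (auto simp: supp2_def)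
  have "tdeg f \<le> 0 \<longleftrightarrow> (\<exists>k. f = C2 k)"
  proof
    assume "tdeg f \<le> 0"
    then have "f = C2 (coeff (coeff f 0) 0)"
      using le[of 0] by (intro poly_eqI) (auto simp: coeff_C2)
    then show "\<exists>k. f = C2 k" ..
  next
    assume "\<exists>k. f = C2 k"
    then show "tdeg f \<le> 0" unfolding le by (auto simp: coeff_C2 split: if_splits)
  qed
  then show ?thesis
    using le[of 1] unfolding affine_form_def by force
qed

text \<open>An automorphism never sends a variable to a constant, so degree at most one and degree
  exactly one coincide here.\<close>

lemma affine_aut_iff: "affine_aut \<phi> \<longleftrightarrow> lin_aut \<phi>"
proof (cases "is_aut \<phi>")
  case True
  have "tdeg (app \<phi> (V p)) = 1 \<longleftrightarrow> affine_form (app \<phi> (V p))" if "is_index p" for p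
    using tdeg_eq_1_iff[OF app_V_nonzero[OF True that]] app_V_nonconst[OF True that] by blast
  from this[of 1] this[of 2] show ?thesis
    using True by (auto simp: affine_aut_def lin_aut_def V_def app_X1 app_X2)
qed (simp add: affine_aut_def lin_aut_def)

lemma gen2_lin_aut:
  fixes S :: "'a::idom endo2 set"
  assumes "\<And>s. s \<in> S \<Longrightarrow> lin_aut s" "\<phi> \<in> gen2 S"
  shows "lin_aut \<phi>"
  using assms(2)
proof induction
  case gen_id
  have "is_aut id2" unfolding is_aut_def using is_inverse2_id2 by blast
  then show ?case by (simp add: lin_aut_def app_id2 affine_form_V)
next
  case (gen_inv s \<psi>)
  show ?case by (rule lin_aut_inverse[OF assms(1)[OF gen_inv(1)] gen_inv(2)])
qed (simp_all add: assms(1) lin_aut_comp2)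

text \<open>Affine automorphisms are already closed under composition and inversion.\<close>

lemma Aff_iff: "(\<phi> :: 'a::idom endo2) \<in> Aff \<longleftrightarrow> lin_aut \<phi>"
  unfolding Aff_def affine_aut_iff
  using gen2_lin_aut[of "Collect lin_aut" \<phi>] gen2.gen_base[of \<phi> "Collect lin_aut"] by blast

lemma aut_over_non_Aff_form:
  fixes \<epsilon> :: "'a::idom endo2"
  assumes "is_index p" "\<epsilon> \<in> aut_over p" "\<epsilon> \<notin> Aff"
  shows "\<exists>u P. u \<noteq> 0 \<and> 2 \<le> degree P \<and> app \<epsilon> (V p) = C2 u * V p + ev1 (V (3 - p)) P"
proof -
  obtain u P where u: "u \<noteq> 0" "app \<epsilon> (V p) = C2 u * V p + ev1 (V (3 - p)) P"
    using aut_over_form[OF assms(1,2)] by blast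
  have "2 \<le> degree P"
  proof (rule ccontr)
    assume "\<not> 2 \<le> degree P"
    then have "degree P \<le> 1" by simp
    then have "P = [:coeff P 0, coeff P 1:]"
      by (intro poly_eqI) (auto simp: coeff_pCons coeff_eq_0 split: nat.splits)
    then obtain b c where P: "P = [:c, b:]" by blast
    have "affine_form (app \<epsilon> (V p))"
      unfolding u(2) P
      by (simp add: affine_form_add affine_form_C2_mult affine_form_C2 affine_form_V mult.commute)
    moreover have "is_aut \<epsilon>" "app \<epsilon> (V (3 - p)) = V (3 - p)"
      using assms(2) by (simp_all only: aut_over_iff[OF assms(1)])
    ultimately have "lin_aut \<epsilon>" using lin_autI[OF _ assms(1)] affine_form_V by metis
    then show False using assms(3) Aff_iff by blast
  qed
  then show ?thesis using u by blast
qed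

text \<open>Here \<open>\<alpha>\<close> maps \<open>V (3 - p')\<close> to
  \<open>m * V (3 - p) + c\<close> with \<open>m\<close> nonzero. Applying \<open>\<beta>\<close>
  and comparing coefficients shows that the image of \<open>V (3 - p)\<close> under
  \<open>\<beta>\<close> is free of \<open>V p'\<close>; thus \<open>\<epsilon>\<close> fixes it,
  and \<open>\<alpha>\<close> carries it back to \<open>V (3 - p)\<close>.\<close>

lemma aut_over_conj:
  fixes \<alpha> :: "'a::idom endo2"
  assumes p: "is_index p" "is_index p'" and a: "lin_aut \<alpha>" "is_inverse2 \<alpha> \<beta>"
    and A: "app \<alpha> (V (3 - p')) \<in> A_sub p" and e: "\<epsilon> \<in> aut_over p'"
  shows "comp2 \<alpha> (comp2 \<epsilon> \<beta>) \<in> aut_over p"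
proof -
  have b: "lin_aut \<beta>" by (rule lin_aut_inverse[OF a])
  have aut: "is_aut \<alpha>" "is_aut \<beta>" "is_aut \<epsilon>" "app \<epsilon> (V (3 - p')) = V (3 - p')"
    using a(1) b e aut_over_iff[OF p(2), of \<epsilon>] by (simp_all add: lin_aut_def)
  obtain m c where 1: "app \<alpha> (V (3 - p')) = C2 m * V (3 - p) + C2 c"
    using a(1) affine_form_A_sub[OF p(1) _ A] unfolding lin_aut_def by blast
  have p3: "is_index (3 - p')" using p(2) by auto
  have m: "m \<noteq> 0" using app_V_nonconst[OF aut(1) p3, of c] 1 by auto
  have 2: "V (3 - p') = C2 m * app \<beta> (V (3 - p)) + C2 c"
    using is_inverse2_app(2)[OF a(2), of "V (3 - p')"] by (simp add: 1)
  obtain s t r where 3: "app \<beta> (V (3 - p)) = C2 s * V p' + C2 t * V (3 - p') + C2 r"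
    using b affine_form_iff[OF p(2)] unfolding lin_aut_def by metis
  have "V (3 - p') = C2 (m * s) * V p' + C2 (m * t) * V (3 - p') + C2 (m * r + c)"
    using 2 unfolding 3 by (simp add: algebra_simps)
  then have "m * s = 0" using V_in_A_sub[OF p(2)] affine_form_A_sub_iff[OF p(2)] by metis
  then have "app \<epsilon> (app \<beta> (V (3 - p))) = app \<beta> (V (3 - p))"
    using m by (simp add: 3 aut(4))
  then show ?thesis
    using aut is_inverse2_app(1)[OF a(2)] by (simp add: aut_over_iff[OF p(1)] is_aut_comp2)
qed

section \<open>Reduced words\<close>

text \<open>\<open>red G p \<psi>\<close> says that \<open>\<psi>\<close> is an alternating product whose last factor is a non-affine
  elementary automorphism over \<open>A_sub p\<close>; the side condition on \<open>\<alpha>\<close> in \<open>step\<close> excludes the words in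
  which two consecutive elementary factors could be merged across \<open>\<alpha>\<close> (\<open>aut_over_conj\<close>).\<close>

inductive red :: "'a::idom endo2 set \<Rightarrow> nat \<Rightarrow> 'a endo2 \<Rightarrow> bool" for G where
  base: "is_index p \<Longrightarrow> \<alpha> \<in> Gbar G \<Longrightarrow> \<epsilon> \<in> aut_over p \<Longrightarrow> \<epsilon> \<notin> Aff \<Longrightarrow> red G p (comp2 \<alpha> \<epsilon>)"
| step: "red G p \<psi> \<Longrightarrow> is_index p' \<Longrightarrow> \<alpha> \<in> Gbar G \<Longrightarrow> app \<alpha> (V (3 - p')) \<notin> A_sub p \<Longrightarrow>
    \<epsilon> \<in> aut_over p' \<Longrightarrow> \<epsilon> \<notin> Aff \<Longrightarrow> red G p' (comp2 (comp2 \<psi> \<alpha>) \<epsilon>)"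

lemma red_index: "red G p \<psi> \<Longrightarrow> is_index p"
  by (induction rule: red.induct)

text \<open>Words without elementary factor are listed separately, since \<open>red\<close> requires
  at least one.\<close>

definition has_reduced_form :: "'a::idom endo2 set \<Rightarrow> 'a endo2 \<Rightarrow> bool" where
  "has_reduced_form G \<phi> \<longleftrightarrow> \<phi> \<in> Gbar G \<or> (\<exists>p \<psi> \<alpha>. red G p \<psi> \<and> \<alpha> \<in> Gbar G \<and> \<phi> = comp2 \<psi> \<alpha>)"

section \<open>Membership and inverses in \<open>Gbar\<close>\<close>

lemma Gbar_comp2: "a \<in> Gbar G \<Longrightarrow> b \<in> Gbar G \<Longrightarrow> comp2 a b \<in> Gbar G"
  unfolding Gbar_def by (rule gen2.gen_comp)

lemma id2_Gbar: "id2 \<in> Gbar G"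
  unfolding Gbar_def by (rule gen2.gen_id)

lemma G_Gbar: "a \<in> G \<Longrightarrow> a \<in> Gbar G"
  unfolding Gbar_def by (simp add: gen2.gen_base)

lemma aut_over_Gbar:
  assumes "is_index p" "\<epsilon> \<in> aut_over p" "\<epsilon> \<in> Aff"
  shows "\<epsilon> \<in> Gbar G"
proof -
  have "\<epsilon> \<in> aut_over 1 \<inter> Aff \<union> aut_over 2 \<inter> Aff" using assms by auto
  then have "\<epsilon> \<in> E0" unfolding E0_def by (rule gen2.gen_base)
  then show ?thesis unfolding Gbar_def by (simp add: gen2.gen_base)
qed

lemma lin_aut_Gbar:
  fixes G :: "'a::idom endo2 set"
  assumes "subgroup2 G Aff" "\<alpha> \<in> Gbar G"
  shows "lin_aut \<alpha>"
proof (rule gen2_lin_aut[OF _ assms(2)[unfolded Gbar_def]])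
  have E0: "lin_aut s" if "s \<in> E0" for s :: "'a endo2"
    using that unfolding E0_def by (rule gen2_lin_aut[rotated]) (auto simp: Aff_iff)
  show "lin_aut s" if "s \<in> G \<union> E0" for s
    using that E0 assms(1) Aff_iff unfolding subgroup2_def by blast
qed

lemma Gbar_inverse:
  fixes G :: "'a::idom endo2 set"
  assumes "subgroup2 G Aff" "\<alpha> \<in> Gbar G"
  obtains \<beta> where "\<beta> \<in> Gbar G" "is_inverse2 \<alpha> \<beta>"
proof -
  have "is_aut s" if "s \<in> G \<union> E0" for s
    using lin_aut_Gbar[OF assms(1), of s] gen2.gen_base[OF that] unfolding Gbar_def lin_aut_def by blast
  then show ?thesis
    using gen2_inverse[of "G \<union> E0" \<alpha>] assms(2) that unfolding Gbar_def by blast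
qed

section \<open>Existence of reduced forms\<close>

lemma has_reduced_form_red:
  assumes "red G p \<psi>" "\<alpha> \<in> Gbar G"
  shows "has_reduced_form G (comp2 \<psi> \<alpha>)"
  using assms unfolding has_reduced_form_def by blast

lemma has_reduced_form_Gbar:
  assumes "has_reduced_form G \<phi>" "\<alpha> \<in> Gbar G"
  shows "has_reduced_form G (comp2 \<phi> \<alpha>)"
  using assms(1) unfolding has_reduced_form_def[of G \<phi>]
proof (elim disjE exE conjE)
  assume "\<phi> \<in> Gbar G"
  then show ?thesis unfolding has_reduced_form_def using Gbar_comp2[OF _ assms(2)] by blast
next
  fix p \<psi> \<beta> assume "red G p \<psi>" "\<beta> \<in> Gbar G" "\<phi> = comp2 \<psi> \<beta>"
  then show ?thesis
    using has_reduced_form_red[OF _ Gbar_comp2[OF _ assms(2)]] by (simp add: comp2_assoc)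
qed

text \<open>The new factor merges with the last one, which is over the same subalgebra. If their
  product becomes affine it passes into \<open>Gbar G\<close>, and the word loses an elementary
  factor.\<close>

lemma red_comp2_aut_over:
  assumes "red G p \<psi>" "\<delta> \<in> aut_over p"
  shows "has_reduced_form G (comp2 \<psi> \<delta>)"
  using assms
proof cases
  case (base \<alpha> \<epsilon>)
  have *: "comp2 \<epsilon> \<delta> \<in> aut_over p" using base assms(2) by (simp only: aut_over_comp2)
  have e: "comp2 \<psi> \<delta> = comp2 \<alpha> (comp2 \<epsilon> \<delta>)" by (simp add: base comp2_assoc)
  show ?thesis
  proof (cases "comp2 \<epsilon> \<delta> \<in> Aff")
    case True
    then have "comp2 \<epsilon> \<delta> \<in> Gbar G" by (rule aut_over_Gbar[OF base(2) *])
    then show ?thesis unfolding e has_reduced_form_def using Gbar_comp2[OF base(3)] by blast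
  next
    case False
    then show ?thesis
      using has_reduced_form_red[OF red.base[OF base(2,3) * False] id2_Gbar] by (simp add: e)
  qed
next
  case (step p' \<psi>' \<alpha> \<epsilon>)
  have *: "comp2 \<epsilon> \<delta> \<in> aut_over p" using step assms(2) by (simp only: aut_over_comp2)
  have e: "comp2 \<psi> \<delta> = comp2 (comp2 \<psi>' \<alpha>) (comp2 \<epsilon> \<delta>)" by (simp add: step comp2_assoc)
  show ?thesis
  proof (cases "comp2 \<epsilon> \<delta> \<in> Aff")
    case True
    then have "comp2 \<epsilon> \<delta> \<in> Gbar G" by (rule aut_over_Gbar[OF step(3) *])
    then show ?thesis
      unfolding e comp2_assoc using has_reduced_form_red[OF step(2) Gbar_comp2[OF step(4)]] by blast
  next
    case False
    then show ?thesis
      using has_reduced_form_red[OF red.step[OF step(2-5) * False] id2_Gbar] by (simp add: e)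
  qed
qed

text \<open>An affine \<open>\<epsilon>\<close> joins the trailing element of \<open>Gbar G\<close>.
  Otherwise, either \<open>\<epsilon>\<close> can be moved across \<open>\<alpha>\<close> by
  conjugation and merged, or the side condition of \<open>step\<close> holds and the word
  grows.\<close>

lemma has_reduced_form_aut_over:
  assumes G: "subgroup2 G Aff" and "has_reduced_form G \<phi>" "is_index p" "\<epsilon> \<in> aut_over p"
  shows "has_reduced_form G (comp2 \<phi> \<epsilon>)"
proof (cases "\<epsilon> \<in> Aff")
  case True
  then show ?thesis using has_reduced_form_Gbar[OF assms(2) aut_over_Gbar[OF assms(3,4)]] by blast
next
  case False
  show ?thesis
    using assms(2) unfolding has_reduced_form_def[of G \<phi>]
  proof (elim disjE exE conjE)
    assume "\<phi> \<in> Gbar G"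
    then show ?thesis
      using has_reduced_form_red[OF red.base[OF assms(3) _ assms(4) False] id2_Gbar] by simp
  next
    fix p' \<psi> \<alpha> assume a: "red G p' \<psi>" "\<alpha> \<in> Gbar G" "\<phi> = comp2 \<psi> \<alpha>"
    show ?thesis
    proof (cases "app \<alpha> (V (3 - p)) \<in> A_sub p'")
      case True
      obtain \<beta> where b: "\<beta> \<in> Gbar G" "is_inverse2 \<alpha> \<beta>" by (rule Gbar_inverse[OF G a(2)])
      have "comp2 \<alpha> (comp2 \<epsilon> \<beta>) \<in> aut_over p'"
        by (rule aut_over_conj[OF red_index[OF a(1)] assms(3) lin_aut_Gbar[OF G a(2)] b(2) True assms(4)])
      from has_reduced_form_Gbar[OF red_comp2_aut_over[OF a(1) this] a(2)]
      have "has_reduced_form G (comp2 \<psi> (comp2 \<alpha> (comp2 \<epsilon> (comp2 \<beta> \<alpha>))))"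
        by (simp add: comp2_assoc)
      then show ?thesis using b(2) by (simp add: is_inverse2_def a(3) comp2_assoc)
    next
      case False
      then show ?thesis
        using has_reduced_form_red[OF red.step[OF a(1) assms(3) a(2) False assms(4) \<open>\<epsilon> \<notin> Aff\<close>] id2_Gbar]
        by (simp add: a(3))
    qed
  qed
qed

lemma Gplus_has_reduced_form:
  assumes G: "subgroup2 G Aff" and "\<phi> \<in> Gplus G"
  shows "has_reduced_form G \<phi>"
proof -
  have gen: "has_reduced_form G (comp2 \<chi> s)" if "s \<in> G \<union> aut_over 1 \<union> aut_over 2" "has_reduced_form G \<chi>" for s \<chi>
    using that has_reduced_form_Gbar[OF _ G_Gbar, of G \<chi> s] has_reduced_form_aut_over[OF G, of \<chi> 1 s]
      has_reduced_form_aut_over[OF G, of \<chi> 2 s] by auto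
  have inv: "\<psi> \<in> G \<union> aut_over 1 \<union> aut_over 2" if "s \<in> G \<union> aut_over 1 \<union> aut_over 2" "is_inverse2 s \<psi>" for s \<psi>
    using that G aut_over_inverse[of 1 s \<psi>] aut_over_inverse[of 2 s \<psi>] unfolding subgroup2_def by blast
  \<comment> \<open>The claim is about right multiplication of an arbitrary reduced form, because
    \<open>gen_comp\<close> multiplies two words rather than a word and a generator.\<close>
  have "\<forall>\<chi>. has_reduced_form G \<chi> \<longrightarrow> has_reduced_form G (comp2 \<chi> \<phi>)"
    using assms(2) unfolding Gplus_def
  proof induction
    case gen_id
    then show ?case by simp
  next
    case (gen_base s)
    then show ?case using gen by blast
  next
    case (gen_inv s \<psi>)
    then show ?case using gen inv by blast
  next
    case (gen_comp a b)
    then show ?case unfolding comp2_assoc[symmetric] by blast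
  qed
  moreover have "has_reduced_form G id2" unfolding has_reduced_form_def using id2_Gbar by blast
  ultimately show ?thesis by fastforce
qed

section \<open>Degrees of reduced words\<close>

text \<open>In the second alternative the only non-affine factor has been absorbed by the weight: up to
  affine maps it is \<open>x\<^sub>m \<mapsto> x\<^sub>m + P(x\<^sub>m\<^sub>')\<close> with \<open>deg P \<cdot> w\<^sub>m\<^sub>' \<le> w\<^sub>m\<close>.\<close>

definition word_degree ::
  "'g::linordered_ab_group_add \<times> 'g \<Rightarrow> nat \<Rightarrow> 'a::idom endo2 \<Rightarrow> 'g \<Rightarrow> bool" where
  "word_degree w p \<psi> D \<longleftrightarrow> 0 < D \<and> has_wdeg w D (app \<psi> (V p)) \<and> wlt w D (app \<psi> (V (3 - p))) \<and>
    ((\<exists>\<chi> \<epsilon>. \<psi> = comp2 \<chi> \<epsilon> \<and> is_aut \<chi> \<and> \<epsilon> \<in> aut_over p \<and> wlt w D (app \<chi> (V p))) \<or>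
     (\<exists>m c d. is_index m \<and> D = wV w m \<and> app \<psi> (V (3 - p)) = C2 c * V (3 - m) + C2 d))"

section \<open>Growth under one elementary factor\<close>

lemma word_degreeI:
  assumes p: "is_index p" and aut: "is_aut \<chi>" and e: "\<epsilon> \<in> aut_over p"
    and "0 < D" "has_wdeg w D (app (comp2 \<chi> \<epsilon>) (V p))"
    and "wlt w D (app \<chi> (V p))" "wlt w D (app \<chi> (V (3 - p)))"
  shows "word_degree w p (comp2 \<chi> \<epsilon>) D"
proof -
  have "app \<epsilon> (V (3 - p)) = V (3 - p)" using e unfolding aut_over_iff[OF p] ..
  then have "wlt w D (app (comp2 \<chi> \<epsilon>) (V (3 - p)))" using assms(7) by simp
  then show ?thesis using assms unfolding word_degree_def by blast
qed

lemma elementary_degree: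
  fixes h g :: "'a::idom bipoly"
  assumes "has_wdeg w d g" "0 < d" "wle w d h" "2 \<le> degree P"
  shows "has_wdeg w (nmul (degree P) d) (C2 u * h + ev1 g P)" "d < nmul (degree P) d"
proof -
  show less: "d < nmul (degree P) d" by (rule less_nmul[OF assms(2,4)])
  have "P \<noteq> 0" using assms(4) by auto
  then show "has_wdeg w (nmul (degree P) d) (C2 u * h + ev1 g P)"
    using has_wdeg_add[OF has_wdeg_ev1[OF assms(1,2)] wle_wlt[OF wle_C2_mult[OF assms(3)] less]]
    by (simp add: add.commute)
qed

text \<open>Both components are bounded by \<open>d\<close>, and the one left fixed by
  \<open>\<epsilon>\<close> attains it. Substituting it into a polynomial of degree at least 2
  therefore lifts the other component strictly above \<open>d\<close>.\<close>

lemma word_degree_elementary: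
  fixes \<epsilon> :: "'a::idom endo2"
  assumes p: "is_index p" and e: "\<epsilon> \<in> aut_over p" "\<epsilon> \<notin> Aff" and aut: "is_aut \<chi>"
    and d: "0 < d" "has_wdeg w d (app \<chi> (V (3 - p)))" "wle w d (app \<chi> (V p))"
  shows "\<exists>D. word_degree w p (comp2 \<chi> \<epsilon>) D"
proof -
  obtain u P where u: "2 \<le> degree P" "app \<epsilon> (V p) = C2 u * V p + ev1 (V (3 - p)) P"
    using aut_over_non_Aff_form[OF p e] by blast
  note deg = elementary_degree(1)[OF d(2,1,3) u(1), of u] elementary_degree(2)[OF d(2,1,3) u(1)]
  have "word_degree w p (comp2 \<chi> \<epsilon>) (nmul (degree P) d)"
  proof (rule word_degreeI[OF p aut e(1)])
    show "0 < nmul (degree P) d" using d(1) deg(2) by simp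
    show "has_wdeg w (nmul (degree P) d) (app (comp2 \<chi> \<epsilon>) (V p))"
      using deg(1) by (simp add: u(2))
    show "wlt w (nmul (degree P) d) (app \<chi> (V p))" by (rule wle_wlt[OF d(3) deg(2)])
    show "wlt w (nmul (degree P) d) (app \<chi> (V (3 - p)))"
      by (rule wle_wlt[OF has_wdeg_wle[OF d(2)] deg(2)])
  qed
  then show ?thesis ..
qed

lemma wle_form:
  assumes "wle w d f" "wle w d g" "0 \<le> d"
  shows "wle w d (C2 a * f + C2 b * g + C2 c)"
  using assms by (intro wle_add wle_C2_mult wle_mono[OF wle_C2])

text \<open>The first factor is the delicate one: the component \<open>g\<close> substituted into
  \<open>P\<close> may be lighter than \<open>h\<close>, and then \<open>P(g)\<close> need not
  dominate.\<close>

lemma word_degree_base: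
  fixes G :: "'a::idom endo2 set"
  assumes G: "subgroup2 G Aff" and w: "fst w > 0 \<or> snd w > 0"
    and p: "is_index p" and a: "\<alpha> \<in> Gbar G" and e: "\<epsilon> \<in> aut_over p" "\<epsilon> \<notin> Aff"
  shows "\<exists>D. word_degree w p (comp2 \<alpha> \<epsilon>) D"
proof -
  \<comment> \<open>An index of maximal weight. As one weight is positive, \<open>W > 0\<close>,
    while \<open>v\<close> may be zero or negative.\<close>
  define m :: nat where "m = (if snd w \<le> fst w then 1 else 2)"
  define W v where "W = wV w m" and "v = wV w (3 - m)"
  have m: "is_index m" by (simp add: m_def)
  have W: "0 < W" "v \<le> W" using w by (auto simp: W_def v_def wV_def m_def)
  have lin: "lin_aut \<alpha>" by (rule lin_aut_Gbar[OF G a])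
  then have aut: "is_aut \<alpha>" by (simp add: lin_aut_def)
  have wleV: "wle w W (V m)" "wle w W (V (3 - m))"
    using has_wdeg_wle[OF has_wdeg_V[of w m]] has_wdeg_wle[OF has_wdeg_V[of w "3 - m"]] W(2) wle_mono
    unfolding W_def v_def by blast+
  define h g where "h = app \<alpha> (V p)" and "g = app \<alpha> (V (3 - p))"
  have aff: "affine_form h" "affine_form g" using lin unfolding lin_aut_def h_def g_def by blast+
  obtain a b k where h: "h = C2 a * V m + C2 b * V (3 - m) + C2 k"
    using aff(1) affine_form_iff[OF m] by blast
  have wleh: "wle w W h" unfolding h by (rule wle_form[OF wleV less_imp_le[OF W(1)]])
  show ?thesis
  proof (cases "g \<in> A_sub m")
    case False
    obtain a' b' k' where g: "g = C2 a' * V m + C2 b' * V (3 - m) + C2 k'"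
      using aff(2) affine_form_iff[OF m] by blast
    have "a' \<noteq> 0" using False affine_form_A_sub_iff[OF m] unfolding g by blast
    moreover have "C2 b' * V (3 - m) + C2 k' \<in> A_sub m"
      using m by (intro A_sub_add A_sub_C2_mult A_sub_C2 V_in_A_sub)
    moreover have "wle w W (C2 b' * V (3 - m) + C2 k')"
      using wleV(2) W(1) by (intro wle_add wle_C2_mult wle_mono[OF wle_C2] less_imp_le)
    ultimately have "has_wdeg w W g"
      using has_wdeg_form[OF m, of "C2 b' * V (3 - m) + C2 k'" a' w] by (simp add: g W_def add.assoc)
    then show ?thesis
      using word_degree_elementary[OF p e aut W(1)] wleh unfolding h_def g_def by blast
  next
    case True
    \<comment> \<open>Now \<open>g\<close> involves only the lighter variable, so \<open>h\<close>
      must involve \<open>V m\<close>.\<close>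
    obtain c d where g: "g = C2 c * V (3 - m) + C2 d"
      using affine_form_A_sub[OF m aff(2) True] by blast
    have p3: "is_index (3 - p)" using p by auto
    have "c \<noteq> 0" using app_V_nonconst[OF aut p3, of d] g by (auto simp: g_def)
    have "h \<notin> A_sub m"
      using not_both_in_A_sub[OF lin m p] True unfolding h_def g_def by blast
    then have "a \<noteq> 0" using affine_form_A_sub_iff[OF m] unfolding h by blast
    obtain u P where u: "u \<noteq> 0" "2 \<le> degree P" "app \<epsilon> (V p) = C2 u * V p + ev1 (V (3 - p)) P"
      using aut_over_non_Aff_form[OF p e] by blast
    have eq: "app \<epsilon> (V (3 - p)) = V (3 - p)" using e(1) unfolding aut_over_iff[OF p] ..
    \<comment> \<open>The part of the new component that is free of \<open>V m\<close>. The
      coefficient \<open>u * a\<close> of \<open>V m\<close> is nonzero, so \<open>V m\<close>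
      survives whatever \<open>r\<close> is.\<close>
    define r where "r = C2 u * (C2 b * V (3 - m) + C2 k) + ev1 g P"
    have \<psi>p: "app (comp2 \<alpha> \<epsilon>) (V p) = C2 (u * a) * V m + r"
      using h u(3) by (simp add: r_def h_def g_def algebra_simps)
    have \<psi>q: "app (comp2 \<alpha> \<epsilon>) (V (3 - p)) = g" by (simp add: eq g_def)
    have r: "r \<in> A_sub m"
    proof -
      obtain Q where "g = ev1 (V (3 - m)) Q" using True A_sub_iff_ev1[OF m] by blast
      then have "ev1 g P = ev1 (V (3 - m)) (pcompose P Q)"
        by (induction P) (simp_all add: pcompose_pCons)
      then have "ev1 g P \<in> A_sub m" using A_sub_iff_ev1[OF m] by blast
      then show ?thesis unfolding r_def
        using m by (intro A_sub_add A_sub_C2_mult A_sub_C2 V_in_A_sub)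
    qed
    \<comment> \<open>The second alternative of \<open>word_degree\<close>, with \<open>V m\<close>
      as a dominant monomial.\<close>
    have absorbed: "word_degree w p (comp2 \<alpha> \<epsilon>) W" if "wle w W r" "wlt w W g"
    proof -
      have "u * a \<noteq> 0" using u(1) \<open>a \<noteq> 0\<close> by simp
      then have "has_wdeg w W (C2 (u * a) * V m + r)"
        unfolding W_def by (rule has_wdeg_form[OF m r _ that(1)[unfolded W_def]])
      then show ?thesis
        unfolding word_degree_def \<psi>p \<psi>q using W(1) that(2) m g W_def by blast
    qed
    have wVv: "has_wdeg w v (V (3 - m) :: 'a bipoly)" unfolding v_def by (rule has_wdeg_V)
    show ?thesis
    proof (cases "0 < v")
      case False
      \<comment> \<open>For \<open>v\<close> at most 0 the substitution stays at degree at most 0,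
        hence below \<open>W\<close>.\<close>
      then have V0: "wle w 0 (V (3 - m) :: 'a bipoly)"
        using wle_mono[OF has_wdeg_wle[OF wVv]] by simp
      have g0: "wle w 0 g" unfolding g by (intro wle_add wle_C2_mult wle_C2 V0)
      have "wle w 0 r" unfolding r_def
        by (intro wle_add wle_C2_mult wle_C2 V0 wle_ev1 g0)
      then show ?thesis
        using absorbed wle_mono[OF _ less_imp_le[OF W(1)]] wle_wlt[OF g0 W(1)] by blast
    next
      case True
      have gv: "has_wdeg w v g"
        unfolding g using \<open>c \<noteq> 0\<close> True by (intro has_wdeg_add has_wdeg_C2_mult wVv wle_wlt[OF wle_C2])
      have kv: "wle w v (C2 b * V (3 - m) + C2 k)"
        using has_wdeg_wle[OF wVv] True by (intro wle_add wle_C2_mult wle_mono[OF wle_C2]) auto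
      define D where "D = nmul (degree P) v"
      have D: "has_wdeg w D r" "v < D"
        using elementary_degree[OF gv True kv u(2)] by (simp_all add: r_def D_def)
      show ?thesis
      \<comment> \<open>Whether the weight absorbs the factor depends on comparing
        \<open>deg P * v\<close> with \<open>W\<close>; equality counts as absorbed, because
        \<open>V m\<close> cannot cancel against \<open>r\<close>.\<close>
      proof (cases "D \<le> W")
        case True
        then show ?thesis
          using absorbed wle_mono[OF has_wdeg_wle[OF D(1)]]
            wle_wlt[OF has_wdeg_wle[OF gv], of W] D(2) by auto
      next
        case False
        then have WD: "W < D" by simp
        have "has_wdeg w D (r + C2 (u * a) * V m)"
          by (intro has_wdeg_add[OF D(1)] wlt_C2_mult wle_wlt[OF wleV(1) WD])
        then have "has_wdeg w D (app (comp2 \<alpha> \<epsilon>) (V p))" unfolding \<psi>p by (simp add: add.commute)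
        then have "word_degree w p (comp2 \<alpha> \<epsilon>) D"
          using W(1) WD wle_wlt[OF wleh WD] wle_wlt[OF has_wdeg_wle[OF gv] D(2)]
            word_degreeI[OF p aut e(1)] less_trans unfolding h_def g_def by blast
        then show ?thesis ..
      qed
    qed
  qed
qed

text \<open>Outside \<open>A_sub p\<close> the coefficient of \<open>V p\<close> is nonzero, and the
  image of \<open>V p\<close> strictly dominates the other terms.\<close>

lemma has_wdeg_app_form:
  fixes \<psi> :: "'a::idom endo2"
  assumes p: "is_index p" and "0 < D" "has_wdeg w D (app \<psi> (V p))" "wlt w D (app \<psi> (V (3 - p)))"
    and f: "affine_form f" "f \<notin> A_sub p"
  shows "has_wdeg w D (app \<psi> f)"
proof -
  obtain a b c where e: "f = C2 a * V p + C2 b * V (3 - p) + C2 c"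
    using f(1) affine_form_iff[OF p] by blast
  have "a \<noteq> 0" using f(2) affine_form_A_sub_iff[OF p] unfolding e by blast
  have "has_wdeg w D (C2 a * app \<psi> (V p) + (C2 b * app \<psi> (V (3 - p)) + C2 c))"
    using assms \<open>a \<noteq> 0\<close>
    by (intro has_wdeg_add has_wdeg_C2_mult wlt_add wlt_C2_mult wle_wlt[OF wle_C2])
  then show ?thesis by (simp add: e add.assoc)
qed

lemma wlt_app_form:
  fixes \<psi> :: "'a::idom endo2"
  assumes p: "is_index p" and "0 < D" "wlt w D (app \<psi> (V p))" "wlt w D (app \<psi> (V (3 - p)))"
    and f: "affine_form f"
  shows "wlt w D (app \<psi> f)"
proof -
  obtain a b c where "f = C2 a * V p + C2 b * V (3 - p) + C2 c"
    using f(1) affine_form_iff[OF p] by blast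
  then show ?thesis using assms by (simp add: wlt_add wlt_C2_mult wle_wlt[OF wle_C2])
qed

lemma wle_app_form:
  fixes \<psi> :: "'a::idom endo2"
  assumes p: "is_index p" and "0 < D" "wle w D (app \<psi> (V p))" "wle w D (app \<psi> (V (3 - p)))"
    and f: "affine_form f"
  shows "wle w D (app \<psi> f)"
proof -
  obtain a b c where "f = C2 a * V p + C2 b * V (3 - p) + C2 c"
    using f(1) affine_form_iff[OF p] by blast
  then show ?thesis using assms by (simp add: wle_form)
qed

text \<open>By the side condition of \<open>step\<close>, \<open>\<alpha>\<close> maps
  \<open>V (3 - p')\<close> to a form involving the dominant variable \<open>V p\<close>. That
  component thus has full degree \<open>D\<close>, as \<open>word_degree_elementary\<close> requires
  for the next factor.\<close>

lemma red_word_degree: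
  fixes G :: "'a::idom endo2 set"
  assumes G: "subgroup2 G Aff" and w: "fst w > 0 \<or> snd w > 0" and "red G p \<psi>"
  shows "is_aut \<psi> \<and> (\<exists>D. word_degree w p \<psi> D)"
  using assms(3)
proof induction
  case (base p \<alpha> \<epsilon>)
  have "is_aut \<alpha>" "is_aut \<epsilon>"
    using lin_aut_Gbar[OF G base(2)] base(3) aut_over_iff[OF base(1), of \<epsilon>] by (simp_all add: lin_aut_def)
  then show ?case using word_degree_base[OF G w base] is_aut_comp2 by blast
next
  case (step p \<psi> p' \<alpha> \<epsilon>)
  have p: "is_index p" by (rule red_index[OF step(1)])
  obtain D where D: "0 < D" "has_wdeg w D (app \<psi> (V p))" "wlt w D (app \<psi> (V (3 - p)))"
    using step.IH unfolding word_degree_def by blast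
  have lin: "lin_aut \<alpha>" by (rule lin_aut_Gbar[OF G step(3)])
  have aff: "affine_form (app \<alpha> (V i))" for i using lin by (simp add: lin_aut_def)
  have aut: "is_aut (comp2 \<psi> \<alpha>)" using step.IH lin is_aut_comp2[of \<psi> \<alpha>] by (simp add: lin_aut_def)
  have "is_aut \<epsilon>" using step(5) aut_over_iff[OF step(2), of \<epsilon>] by simp
  have "has_wdeg w D (app (comp2 \<psi> \<alpha>) (V (3 - p')))"
    using has_wdeg_app_form[OF p D aff step(4)] by simp
  moreover have "wle w D (app (comp2 \<psi> \<alpha>) (V p'))"
    using wle_app_form[OF p D(1) has_wdeg_wle[OF D(2)] wlt_wle[OF D(3)] aff] by simp
  ultimately show ?case
    using word_degree_elementary[OF step(2,5,6) aut D(1)] is_aut_comp2[OF aut \<open>is_aut \<epsilon>\<close>] by blast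
qed

section \<open>Construction of the reduction\<close>

lemma translation:
  fixes k :: "'a::idom"
  assumes "is_index i"
  shows "\<exists>\<tau>\<in>aut_over i. app \<tau> (V i) = V i + C2 k"
proof -
  define t :: "'a \<Rightarrow> 'a endo2" where "t k = (if i = 1 then (X1 + C2 k, X2) else (X1, X2 + C2 k))" for k
  have t: "app (t k) (V i) = V i + C2 k" "app (t k) (V (3 - i)) = V (3 - i)" for k
    using assms by (auto simp: t_def V_def app_X1 app_X2)
  have "comp2 (t k) (t l) = id2" if "k + l = 0" for k l
    using that by (intro endo2_eqI[OF assms])
      (simp_all add: t app_id2 add.assoc flip: C2_simps(3))
  then have "is_inverse2 (t k) (t (- k))" unfolding is_inverse2_def by simp
  then have "is_aut (t k)" unfolding is_aut_def ..
  then have "t k \<in> aut_over i" using t(2) aut_over_iff[OF assms, of "t k"] by blast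
  then show ?thesis using t(1) by blast
qed

theorem theorem1p2p1:
  fixes G :: "'a::idom endo2 set"
    and w :: "'g::linordered_ab_group_add \<times> 'g"
    and \<phi> :: "'a endo2"
  assumes "fin_gen_group TYPE('g)"
    and "subgroup2 G Aff"
    and "fst w > 0 \<or> snd w > 0"
    and "\<phi> \<in> Gplus G"
    and "wdeg_endo w \<phi> > wnorm w"
  shows "(\<exists>\<alpha>\<in>Gbar G. wdeg_endo w (comp2 \<phi> \<alpha>) < wdeg_endo w \<phi>)
       \<or> (\<exists>i\<in>{1, 2}. \<exists>\<epsilon>\<in>aut_over i. wdeg_endo w (comp2 \<phi> \<epsilon>) < wdeg_endo w \<phi>)"
  using Gplus_has_reduced_form[OF assms(2,4)] unfolding has_reduced_form_def
proof (elim disjE exE conjE)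
  assume "\<phi> \<in> Gbar G"
  then obtain \<beta> where b: "\<beta> \<in> Gbar G" "is_inverse2 \<phi> \<beta>" by (rule Gbar_inverse[OF assms(2)])
  \<comment> \<open>The inverse of \<open>\<phi>\<close> lies in \<open>Gbar G\<close> and leads to
    the identity, whose degree is \<open>wnorm w\<close>.\<close>
  have "wdeg_endo w (id2 :: 'a endo2) = wnorm w"
    by (simp add: wdeg_endo_eq[of 1] wnorm_eq[of 1] app_id2 wdeg_eqI[OF has_wdeg_V])
  then have "wdeg_endo w (comp2 \<phi> \<beta>) < wdeg_endo w \<phi>"
    using b(2) assms(5) by (simp add: is_inverse2_def)
  then show ?thesis using b(1) by blast
next
  fix p \<psi> \<alpha> assume r: "red G p \<psi>" and a: "\<alpha> \<in> Gbar G" and \<phi>: "\<phi> = comp2 \<psi> \<alpha>"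
  have p: "is_index p" by (rule red_index[OF r])
  then have p3: "is_index (3 - p)" by auto
  obtain D where aut\<psi>: "is_aut \<psi>" and wd: "word_degree w p \<psi> D"
    using red_word_degree[OF assms(2,3) r] by blast
  then have D: "0 < D" "has_wdeg w D (app \<psi> (V p))" "wlt w D (app \<psi> (V (3 - p)))"
    unfolding word_degree_def by blast+
  have lin: "lin_aut \<alpha>" by (rule lin_aut_Gbar[OF assms(2) a])
  then have aff: "affine_form (app \<alpha> (V i))" and aut\<alpha>: "is_aut \<alpha>" for i by (simp_all add: lin_aut_def)
  have aut\<phi>: "is_aut \<phi>" unfolding \<phi> by (rule is_aut_comp2[OF aut\<psi> aut\<alpha>])
  obtain \<beta> where b: "\<beta> \<in> Gbar G" "is_inverse2 \<alpha> \<beta>" by (rule Gbar_inverse[OF assms(2) a])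
  have top: "wdeg w (app \<phi> (V i)) = D" if "app \<alpha> (V i) \<notin> A_sub p" for i
    using wdeg_eqI[OF has_wdeg_app_form[OF p D aff that]] by (simp add: \<phi>)
  show ?thesis
  proof (cases "app \<alpha> (V 1) \<notin> A_sub p \<and> app \<alpha> (V 2) \<notin> A_sub p")
    case True
    \<comment> \<open>Both components of \<open>\<phi>\<close> have degree \<open>D\<close>; undoing
      \<open>\<alpha>\<close> leaves only one of degree \<open>D\<close>.\<close>
    have "comp2 \<phi> \<beta> = \<psi>" using b(2) by (simp add: \<phi> comp2_assoc is_inverse2_def)
    moreover have "wdeg_endo w \<phi> = D + D" using True top by (simp add: wdeg_endo_eq[of 1])
    moreover have "wdeg_endo w \<psi> < D + D"
      using wdeg_eqI[OF D(2)] wdeg_less[OF app_V_nonzero[OF aut\<psi> p3] D(3)]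
      by (simp add: wdeg_endo_eq[OF p])
    ultimately show ?thesis using b(1) by auto
  next
    case False
    then obtain j where j: "is_index j" "app \<alpha> (V j) \<in> A_sub p" by blast
    \<comment> \<open>The image of \<open>V j\<close> under \<open>\<alpha>\<close> misses the
      dominant variable, that of \<open>V i\<close> contains it. The reduction alters
      \<open>V i\<close> in the strict case and \<open>V j\<close> in the absorbed case.\<close>
    define i where "i = 3 - j"
    have i: "is_index i" "3 - i = j" using j(1) by (auto simp: i_def)
    have ai: "app \<alpha> (V i) \<notin> A_sub p" using not_both_in_A_sub[OF lin p j(1)] j(2) by (simp add: i_def)
    obtain s t where st: "app \<alpha> (V j) = C2 s * V (3 - p) + C2 t"
      using affine_form_A_sub[OF p aff j(2)] by blast
    have deg\<phi>: "wdeg_endo w \<phi> = D + wdeg w (app \<phi> (V j))"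
      using top[OF ai] wdeg_endo_eq[OF i(1), of w \<phi>] i(2) by simp
    from wd consider
      (strict) \<chi> \<epsilon> where "\<psi> = comp2 \<chi> \<epsilon>" "is_aut \<chi>" "\<epsilon> \<in> aut_over p" "wlt w D (app \<chi> (V p))"
    | (absorbed) m c d where "is_index m" "D = wV w m" "app \<psi> (V (3 - p)) = C2 c * V (3 - m) + C2 d"
      unfolding word_degree_def by blast
    then show ?thesis
    proof cases
      case strict
      obtain \<delta> where d: "is_inverse2 \<epsilon> \<delta>" "\<delta> \<in> aut_over p"
        using strict(3) aut_over_inverse[OF p] aut_over_iff[OF p] unfolding is_aut_def by metis
      have \<chi>q: "app \<chi> (V (3 - p)) = app \<psi> (V (3 - p))"
        using strict(1,3) aut_over_iff[OF p, of \<epsilon>] by simp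
      \<comment> \<open>This cancels the last factor: \<open>comp2 \<phi> \<eta>\<close> is
        \<open>comp2 \<chi> \<alpha>\<close>. It fixes \<open>V j\<close> because
        \<open>\<delta>\<close> fixes \<open>V (3 - p)\<close>, the only variable in the image of
        \<open>V j\<close> under \<open>\<alpha>\<close>.\<close>
      define \<eta> where "\<eta> = comp2 \<beta> (comp2 \<delta> \<alpha>)"
      have jj: "app \<delta> (app \<alpha> (V j)) = app \<alpha> (V j)"
        using d(2) aut_over_iff[OF p, of \<delta>] by (simp add: st)
      have "is_aut \<eta>" unfolding \<eta>_def
        using is_aut_comp2 aut\<alpha> b(2) d is_inverse2_sym unfolding is_aut_def by metis
      moreover have "app \<eta> (V j) = V j" using is_inverse2_app(2)[OF b(2)] by (simp add: \<eta>_def jj)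
      ultimately have \<eta>: "\<eta> \<in> aut_over i" using aut_over_iff[OF i(1), of \<eta>] i(2) by simp
      have app\<eta>: "app (comp2 \<phi> \<eta>) f = app \<chi> (app \<alpha> f)" for f
        using is_inverse2_app(1)[OF b(2)] is_inverse2_app(1)[OF d(1)]
        by (simp add: \<phi> \<eta>_def strict(1))
      have "wlt w D (app \<chi> (app \<alpha> (V i)))"
        using wlt_app_form[OF p D(1) strict(4) _ aff] D(3) by (simp add: \<chi>q)
      moreover have "app \<chi> (app \<alpha> (V i)) \<noteq> 0"
        using app_V_nonzero[OF is_aut_comp2[OF strict(2) aut\<alpha>] i(1)] by simp
      ultimately have "wdeg w (app \<chi> (app \<alpha> (V i))) < D" by (intro wdeg_less)
      moreover have "app (comp2 \<phi> \<eta>) (V j) = app \<phi> (V j)"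
        unfolding app\<eta> by (simp add: \<phi> st \<chi>q)
      ultimately have "wdeg_endo w (comp2 \<phi> \<eta>) < wdeg_endo w \<phi>"
        unfolding deg\<phi> wdeg_endo_eq[OF i(1), of w "comp2 \<phi> \<eta>"] i(2) app\<eta>[of "V i"] by simp
      then show ?thesis using \<eta> i(1) by blast
    next
      case absorbed
      have \<phi>j: "app \<phi> (V j) = C2 (s * c) * V (3 - m) + C2 (s * d + t)"
        by (simp add: \<phi> st absorbed(3) algebra_simps)
      have "s * c \<noteq> 0" using app_V_nonconst[OF aut\<phi> j(1)] \<phi>j by (metis C2_simps(1) add_0 mult_zero_left)
      \<comment> \<open>The constant term raises the degree when \<open>V (3 - m)\<close> has
        negative weight. Removing it leaves the total \<open>wV w m + wV w (3 - m)\<close>, which is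
        \<open>wnorm w\<close>.\<close>
      obtain \<tau> where \<tau>: "\<tau> \<in> aut_over j" "app \<tau> (V j) = V j + C2 (- (s * d + t))"
        using translation[OF j(1)] by blast
      have "app \<tau> (V i) = V i" using \<tau>(1) aut_over_iff[OF j(1), of \<tau>] by (simp add: i_def)
      then have "app (comp2 \<phi> \<tau>) (V i) = app \<phi> (V i)" by simp
      moreover have "app (comp2 \<phi> \<tau>) (V j) = C2 (s * c) * V (3 - m)"
        by (simp add: \<tau>(2) \<phi>j)
      moreover have "wdeg w (C2 (s * c) * V (3 - m)) = wV w (3 - m)"
        by (rule wdeg_eqI[OF has_wdeg_C2_mult[OF \<open>s * c \<noteq> 0\<close> has_wdeg_V]])
      ultimately have "wdeg_endo w (comp2 \<phi> \<tau>) = D + wV w (3 - m)"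
        using wdeg_endo_eq[OF i(1), of w "comp2 \<phi> \<tau>"] i(2) top[OF ai] by simp
      also have "\<dots> = wnorm w" by (simp add: absorbed(2) wnorm_eq[OF absorbed(1)])
      finally have "wdeg_endo w (comp2 \<phi> \<tau>) < wdeg_endo w \<phi>" using assms(5) by simp
      then show ?thesis using \<tau>(1) j(1) by blast
    qed
  qed
qed

end
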